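(* Let $g:[0,1]\to[0,\infty)$ be continuously differentiable and let $\varphi=(\varphi_{kl}):[0,\infty)\to\mathcal M_p([0,\infty))$ be such that $\int_0^\infty\varphi_{kl}(t)\,dt<\infty$ for all $k,l$ and the matrix with coefficients $\|g\|_{L^\infty}\int_0^\infty\varphi_{kl}(t)\,dt$ has spectral radius less than $1$. Let $m:[0,1]\to\mathbb R^p$ be continuous. Then, as $T\to\infty$, $$\sup_{u\in[0,1]}\Big\|\frac1T\int_0^{Tu}\int_s^{Tu}K^T(t,s)\,m\big(\tfrac sT\big)\,dt\,ds-\int_0^u\Big(\int_0^\infty\Psi(x,s)\,ds\Big)m(x)\,dx\Big\|\to0 .$$ If furthermore $m$ is Lipschitz-continuous and $\int_0^\infty\varphi_{kl}(s)\sqrt s\,ds<\infty$ for all $k,l$, then the convergence occurs at rate $o\big(\tfrac1{\sqrt T}\big)$.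
   Context: $\mathcal M_p(E)$ denotes the $p\times p$ matrices with entries in $E$, $\|g\|_{L^\infty}=\sup_{[0,1]}g$, and $\|\cdot\|$ is a norm on $\mathbb R^p$; $\varphi$ is measurable and extended by $0$ to $(-\infty,0)$. For matrix-valued Volterra kernels (functions $a(t,s)$ vanishing for $s>t$), $(a\star b)(t,s)=\int_s^t a(t,u)b(u,s)\,du$, and $a^{\star1}=a$, $a^{\star(i+1)}=a\star a^{\star i}$. For $T>0$ and $(s,t)\in[0,T]^2$, $k^T(t,s)=g(t/T)\varphi(t-s)$ and its resolvent is $K^T=\sum_{i\ge1}(k^T)^{\star i}$ (convergent for almost every $(s,t)$). For $x\in[0,1]$, $\Psi(x,t)=\sum_{i\ge1}g(x)^i\varphi^{\star i}(t)$, where here $\varphi^{\star i}$ is the $i$-fold convolution $(f\star h)(t)=\int_0^tf(t-s)h(s)\,ds$; the series converges in $L^1[0,\infty)$. *)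

theory Defs
  imports "HOL-Analysis.Analysis" "Jordan_Normal_Form.Spectral_Radius"
begin

hide_type (open) Matrix.vec
hide_const (open) Matrix.vec
no_notation Matrix.vec_index (infixl "$" 100)

definition is_norm :: "('a::real_vector \<Rightarrow> real) \<Rightarrow> bool" where
  "is_norm N \<longleftrightarrow>
     (\<forall>x. N x = 0 \<longleftrightarrow> x = 0) \<and>
     (\<forall>x y. N (x + y) \<le> N x + N y) \<and>
     (\<forall>c x. N (c *\<^sub>R x) = \<bar>c\<bar> * N x)"

text \<open>The function \<open>from_nat_into UNIV\<close> enumerates the index type by \<open>0, \<dots>, CARD('p) - 1\<close>.
  Changing the enumeration conjugates the matrix by a permutation, so the spectral radius does not
  depend on it.\<close>

definition cmat_of :: "real ^ 'p ^ 'p \<Rightarrow> complex mat" where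
  "cmat_of A = Matrix.mat CARD('p) CARD('p)
     (\<lambda>(i, j). complex_of_real (A $ from_nat_into UNIV i $ from_nat_into UNIV j))"

text \<open>A kernel \<open>a\<close> takes the arguments in the order \<open>a t s\<close>. In the iterates below, \<open>i \<ge> 1\<close>.\<close>

definition volterra ::
  "(real \<Rightarrow> real \<Rightarrow> real ^ 'p ^ 'p) \<Rightarrow> (real \<Rightarrow> real \<Rightarrow> real ^ 'p ^ 'p) \<Rightarrow> real \<Rightarrow> real \<Rightarrow> real ^ 'p ^ 'p"
  where "volterra a b t s = (LINT u:{s..t}|lebesgue. a t u ** b u s)"

definition volterra_power ::
  "(real \<Rightarrow> real \<Rightarrow> real ^ 'p ^ 'p) \<Rightarrow> nat \<Rightarrow> real \<Rightarrow> real \<Rightarrow> real ^ 'p ^ 'p"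
  where "volterra_power a i = (volterra a ^^ (i - 1)) a"

definition conv ::
  "(real \<Rightarrow> real ^ 'p ^ 'p) \<Rightarrow> (real \<Rightarrow> real ^ 'p ^ 'p) \<Rightarrow> real \<Rightarrow> real ^ 'p ^ 'p"
  where "conv f h t = (LINT s:{0..t}|lebesgue. f (t - s) ** h s)"

definition conv_power :: "(real \<Rightarrow> real ^ 'p ^ 'p) \<Rightarrow> nat \<Rightarrow> real \<Rightarrow> real ^ 'p ^ 'p"
  where "conv_power f i = (conv f ^^ (i - 1)) f"

definition kernel ::
  "(real \<Rightarrow> real) \<Rightarrow> (real \<Rightarrow> real ^ 'p ^ 'p) \<Rightarrow> real \<Rightarrow> real \<Rightarrow> real \<Rightarrow> real ^ 'p ^ 'p"
  where "kernel g \<phi> T t s = g (t / T) *\<^sub>R \<phi> (t - s)"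

text \<open>Both series below are taken pointwise. They converge only almost everywhere in general;
  on the exceptional null set \<open>suminf\<close> has an unspecified value, which no integral sees.
  All terms are entrywise nonnegative when \<open>g\<close> and \<open>\<phi>\<close> are, so if the partial sums of \<open>Psi g \<phi> x\<close>
  converge in \<open>L\<^sup>1\<close>, their limit is the pointwise sum almost everywhere.\<close>

definition resolvent ::
  "(real \<Rightarrow> real) \<Rightarrow> (real \<Rightarrow> real ^ 'p ^ 'p) \<Rightarrow> real \<Rightarrow> real \<Rightarrow> real \<Rightarrow> real ^ 'p ^ 'p"
  where "resolvent g \<phi> T t s = (\<Sum>i. volterra_power (kernel g \<phi> T) (Suc i) t s)"

definition Psi ::
  "(real \<Rightarrow> real) \<Rightarrow> (real \<Rightarrow> real ^ 'p ^ 'p) \<Rightarrow> real \<Rightarrow> real \<Rightarrow> real ^ 'p ^ 'p"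
  where "Psi g \<phi> x t = (\<Sum>i. g x ^ Suc i *\<^sub>R conv_power \<phi> (Suc i) t)"

definition deviation ::
  "(real \<Rightarrow> real) \<Rightarrow> (real \<Rightarrow> real ^ 'p ^ 'p) \<Rightarrow> (real \<Rightarrow> real ^ 'p) \<Rightarrow> real \<Rightarrow> real \<Rightarrow> real ^ 'p"
  where "deviation g \<phi> m T u =
    (1 / T) *\<^sub>R (LINT s:{0..T * u}|lebesgue.
                  (LINT t:{s..T * u}|lebesgue. resolvent g \<phi> T t s *v m (s / T)))
    - (LINT x:{0..u}|lebesgue. (LINT s:{0..}|lebesgue. Psi g \<phi> x s) *v m x)"

end

theory Submission
  imports Defs
begin

text \<open>Fix the second argument \<open>s\<close> of the resolvent. Then \<open>v \<mapsto> (k\<^sup>T)\<^sup>\<star>\<^sup>i(s + v, s)\<close> solves the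
  one-variable recursion \<open>W\<^sub>1 = \<gamma> \<phi>\<close>, \<open>W\<^sub>i\<^sub>+\<^sub>1 = \<gamma> (\<phi> \<star> W\<^sub>i)\<close> with \<open>\<gamma> v = g ((s + v) / T)\<close>, while \<open>\<Psi>\<close> at
  \<open>x = s / T\<close> comes from the same recursion with the constant weight \<open>\<gamma> = g x\<close>. If two weights bounded by
  \<open>G\<close> differ by at most a nondecreasing \<open>\<delta>\<close>, induction on \<open>i\<close> shows that their iterates differ at
  \<open>v\<close> by at most \<open>i (\<delta> v / G)\<close> times the iterate for the constant weight \<open>G\<close>; here
  \<open>\<delta> v = L min (v / T) 1\<close> since \<open>g\<close> is Lipschitz. The subcriticality assumption yields a positive vector
  \<open>w\<close> with \<open>G (\<integral>\<phi>) w \<le> \<rho> w\<close>, \<open>\<rho> < 1\<close>, from which the function \<open>S\<close> obtained by summing \<open>i\<close> times the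
  \<open>i\<close>-th iterate for \<open>G\<close> is integrable, and \<open>S v sqrt v\<close> is integrable if \<open>\<phi> v sqrt v\<close> is.
  Hence the deviation is at most a constant times \<open>\<integral> min (v / T) 1 S v dv\<close>, the contribution of the truncation
  of the inner integral at \<open>Tu\<close> included, and dominated convergence gives both rates.\<close>

section \<open>Strict supersolutions for matrices of spectral radius less than one\<close>

lemma cmat_of_carrier: "cmat_of (A :: real ^ 'p ^ 'p) \<in> carrier_mat CARD('p) CARD('p)"
  by (simp add: cmat_of_def)

lemma smult_mat_mult_vec:
  fixes M :: "'a :: comm_semiring_0 mat"
  assumes "M \<in> carrier_mat n m" "v \<in> carrier_vec m"
  shows "(c \<cdot>\<^sub>m M) *\<^sub>v v = c \<cdot>\<^sub>v (M *\<^sub>v v)"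
  using assms by (intro eq_vecI) (auto simp: scalar_prod_def sum_distrib_left mult.assoc)

text \<open>An eigenvector of \<open>r M\<close> for \<open>k\<close> is an eigenvector of
  \<open>M\<close> for \<open>k / r\<close>; take \<open>k\<close> of maximal modulus. This makes
  room to inflate a matrix by a factor above 1 while its spectral radius stays below 1.\<close>

lemma spectral_radius_smult_le:
  fixes M :: "complex mat"
  assumes M: "M \<in> carrier_mat n n" and n: "n > 0" and r: "r > 0"
  shows "spectral_radius (complex_of_real r \<cdot>\<^sub>m M) \<le> r * spectral_radius M"
proof -
  let ?B = "complex_of_real r \<cdot>\<^sub>m M"
  have B: "?B \<in> carrier_mat n n" using M by simp
  obtain k where k: "eigenvalue ?B k" and eq: "spectral_radius ?B = norm k"
    using spectral_radius_mem_max(1)[OF B n] by (auto simp: spectrum_def)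
  then obtain v where v: "v \<in> carrier_vec n" "v \<noteq> 0\<^sub>v n" "?B *\<^sub>v v = k \<cdot>\<^sub>v v"
    using B M by (auto simp: eigenvalue_def eigenvector_def)
  have "complex_of_real r \<cdot>\<^sub>v (M *\<^sub>v v) = k \<cdot>\<^sub>v v"
    using v M by (metis smult_mat_mult_vec)
  then have "(1 / complex_of_real r) \<cdot>\<^sub>v (complex_of_real r \<cdot>\<^sub>v (M *\<^sub>v v)) = (k / r) \<cdot>\<^sub>v v"
    by (simp add: smult_smult_assoc)
  then have "M *\<^sub>v v = (k / r) \<cdot>\<^sub>v v"
    using r by (simp add: smult_smult_assoc)
  then have "eigenvalue M (k / r)"
    using v M by (auto simp: eigenvalue_def eigenvector_def)
  then have "norm (k / r) \<le> spectral_radius M"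
    by (intro spectral_radius_mem_max(2)[OF M n]) (auto simp: spectrum_def)
  then show ?thesis
    using r eq by (simp add: norm_divide field_simps)
qed

text \<open>A bridge between powers of the complex matrix, which the Jordan normal form bounds, and
  iterates of a real map on functions of the index type, in which the positivity arguments are
  carried out.\<close>

lemma cmat_of_pow_mult_vec:
  fixes A :: "real ^ 'p ^ 'p" and r :: real
  defines "F \<equiv> (\<lambda>y i. r * (\<Sum>j\<in>UNIV. A $ i $ j * y j))"
    and "e \<equiv> from_nat_into (UNIV :: 'p set)"
  shows "(complex_of_real r \<cdot>\<^sub>m cmat_of A) ^\<^sub>m k *\<^sub>v Matrix.vec CARD('p) (\<lambda>i. complex_of_real (y (e i))) =
         Matrix.vec CARD('p) (\<lambda>i. complex_of_real ((F ^^ k) y (e i)))"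
proof (induction k arbitrary: y)
  case 0
  show ?case by (simp add: cmat_of_def)
next
  case (Suc k)
  let ?n = "CARD('p)" and ?B = "complex_of_real r \<cdot>\<^sub>m cmat_of A"
  have B: "?B \<in> carrier_mat ?n ?n" by (simp add: cmat_of_def)
  have bij: "bij_betw e {0..<?n} UNIV"
    unfolding e_def using bij_betw_from_nat_into_finite[of "UNIV :: 'p set"]
    by (simp add: lessThan_atLeast0)
  have "?B *\<^sub>v Matrix.vec ?n (\<lambda>i. complex_of_real (y (e i))) =
      Matrix.vec ?n (\<lambda>i. complex_of_real (F y (e i)))"
  proof (rule eq_vecI)
    fix i assume "i < dim_vec (Matrix.vec ?n (\<lambda>i. complex_of_real (F y (e i))))"
    then have i: "i < ?n" by simp
    have "vec_index (?B *\<^sub>v Matrix.vec ?n (\<lambda>i. complex_of_real (y (e i)))) i =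
        complex_of_real (\<Sum>j\<in>{0..<?n}. r * (A $ e i $ e j * y (e j)))"
      using i by (simp add: cmat_of_def scalar_prod_def e_def mult.assoc)
    also have "(\<Sum>j\<in>{0..<?n}. r * (A $ e i $ e j * y (e j))) = F y (e i)"
      unfolding F_def sum_distrib_left
      by (rule sum.reindex_bij_betw[OF bij, of "\<lambda>j. r * (A $ e i $ j * y j)"])
    finally show "vec_index (?B *\<^sub>v Matrix.vec ?n (\<lambda>i. complex_of_real (y (e i)))) i =
        vec_index (Matrix.vec ?n (\<lambda>i. complex_of_real (F y (e i)))) i"
      using i by simp
  qed (simp add: cmat_of_def)
  moreover have "?B ^\<^sub>m Suc k *\<^sub>v Matrix.vec ?n (\<lambda>i. complex_of_real (y (e i))) =
      ?B ^\<^sub>m k *\<^sub>v (?B *\<^sub>v Matrix.vec ?n (\<lambda>i. complex_of_real (y (e i))))"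
    using B by (simp add: assoc_mult_mat_vec[of _ ?n ?n _ ?n])
  ultimately show ?case
    using Suc.IH[of "F y"] by (simp add: funpow_swap1)
qed

text \<open>For \<open>r > 1\<close> such that \<open>r A\<close> still has spectral radius below 1,
  the vectors \<open>x k\<close>, the k-th power of \<open>r A\<close> applied to the all-ones
  vector, stay bounded, so the sum \<open>w\<close> of \<open>q ^ k x k\<close> converges for
  \<open>q < 1\<close>. As \<open>A\<close> shifts this series,
  \<open>A w = (w - 1) / (q r)\<close>, and \<open>q r > 1\<close> yields the factor. The term
  \<open>k = 0\<close> keeps every entry at least 1, which a Perron eigenvector of a reducible
  matrix does not guarantee.\<close>

lemma spectral_radius_less_1_strict_supersolution:
  fixes A :: "real ^ 'p ^ 'p"
  assumes nonneg: "\<And>k l. A $ k $ l \<ge> 0" and sr: "spectral_radius (cmat_of A) < 1"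
  obtains w \<rho> where "0 < \<rho>" "\<rho> < 1" "\<And>k. w k \<ge> (1::real)"
    "\<And>k. (\<Sum>l\<in>UNIV. A $ k $ l * w l) \<le> \<rho> * w k"
proof -
  let ?n = "CARD('p)" and ?\<sigma> = "spectral_radius (cmat_of A)"
  have n: "?n > 0" by simp
  have "?\<sigma> \<ge> 0"
    using spectral_radius_mem_max(1)[OF cmat_of_carrier n, of A] by auto
  \<comment> \<open>Any \<open>r > 1\<close> with \<open>r ?\<sigma> < 1\<close> would do; this
    choice also covers \<open>?\<sigma> = 0\<close>.\<close>
  define r where "r = 2 / (1 + ?\<sigma>)"
  have r: "r > 1" "r * ?\<sigma> < 1"
    using \<open>?\<sigma> \<ge> 0\<close> sr by (auto simp: r_def field_simps)
  define B where "B = complex_of_real r \<cdot>\<^sub>m cmat_of A"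
  have B: "B \<in> carrier_mat ?n ?n" by (simp add: B_def cmat_of_def)
  have "spectral_radius B < 1"
    using spectral_radius_smult_le[OF cmat_of_carrier n, of r A] r by (simp add: B_def)
  \<comment> \<open>Over the complex numbers the characteristic polynomial splits, so a Jordan form
    exists; with spectral radius below 1 it bounds the entries of all powers by one
    constant.\<close>
  moreover have "\<exists>n_as. jordan_nf B n_as"
    using char_poly_factorized[OF B] jordan_nf_iff_linear_factorization[OF B] by blast
  ultimately obtain c where c: "norm_bound (B ^\<^sub>m k) c" for k
    using spectral_radius_jnf_norm_bound_less_1[OF B] by blast
  define F where "F = (\<lambda>y i. r * (\<Sum>j\<in>UNIV. A $ i $ j * y j))"
  define x where "x k = (F ^^ k) (\<lambda>_. 1)" for k
  have x_Suc: "x (Suc k) i = r * (\<Sum>j\<in>UNIV. A $ i $ j * x k j)" for k i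
    by (simp add: x_def F_def)
  have x_0: "x 0 i = 1" for i
    by (simp add: x_def)
  have x_nonneg: "x k i \<ge> 0" for k i
  proof (induction k arbitrary: i)
    case (Suc k)
    then show ?case using r nonneg by (auto simp: x_Suc intro!: mult_nonneg_nonneg sum_nonneg)
  qed (simp add: x_def)
  have x_le: "x k i \<le> ?n * c" for k i
  proof -
    obtain a where a: "a < ?n" "from_nat_into UNIV a = i"
      using bij_betw_from_nat_into_finite[of "UNIV :: 'p set"] unfolding bij_betw_def
      by (metis finite_class.finite_UNIV UNIV_I imageE lessThan_iff)
    have Bk: "B ^\<^sub>m k \<in> carrier_mat ?n ?n" using B by simp
    have "complex_of_real (x k i) = vec_index (B ^\<^sub>m k *\<^sub>v Matrix.vec ?n (\<lambda>i. complex_of_real 1)) a"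
      unfolding B_def cmat_of_pow_mult_vec[of r A k "\<lambda>_. 1", folded F_def] using a
      by (simp add: x_def)
    also have "\<dots> = (\<Sum>j\<in>{0..<?n}. (B ^\<^sub>m k) $$ (a, j))"
      using a carrier_matD[OF Bk] by (simp add: scalar_prod_def)
    finally have eq: "complex_of_real (x k i) = (\<Sum>j\<in>{0..<?n}. (B ^\<^sub>m k) $$ (a, j))" .
    have "norm ((B ^\<^sub>m k) $$ (a, j)) \<le> c" if "j < ?n" for j
      using c[of k, unfolded norm_bound_def carrier_matD[OF Bk]] a that by blast
    then have "norm (complex_of_real (x k i)) \<le> (\<Sum>j\<in>{0..<?n}. c)"
      unfolding eq by (intro sum_norm_le) simp
    then show ?thesis using x_nonneg[of k i] by simp
  qed
  \<comment> \<open>Then \<open>q r = (1 + r) / 2\<close> lies strictly between 1 and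
    \<open>r\<close>.\<close>
  define q where "q = (1 + r) / 2 / r"
  have q: "0 < q" "q < 1" "q * r > 1"
    using r by (auto simp: q_def field_simps)
  have summable: "summable (\<lambda>k. q ^ k * x k i)" for i
  proof (rule summable_comparison_test')
    show "summable (\<lambda>k. q ^ k * (?n * c))"
      using q by (intro summable_mult2 summable_geometric) simp
    show "norm (q ^ k * x k i) \<le> q ^ k * (?n * c)" for k
      using q x_nonneg[of k i] x_le[of k i] by (simp add: abs_mult)
  qed
  define w where "w i = (\<Sum>k. q ^ k * x k i)" for i
  have w_split: "w i = 1 + (\<Sum>k. q ^ Suc k * x (Suc k) i)" for i
    using suminf_split_head[OF summable[of i]] by (simp add: w_def x_0 del: power_Suc)
  have "w i \<ge> 1" for i
    unfolding w_split using q x_nonneg summable_Suc_iff[of "\<lambda>k. q ^ k * x k i"] summable[of i]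
    by (auto intro!: suminf_nonneg simp del: power_Suc)
  moreover have "(\<Sum>j\<in>UNIV. A $ i $ j * w j) \<le> 1 / (q * r) * w i" for i
  proof -
    have "(\<Sum>j\<in>UNIV. A $ i $ j * w j) = (\<Sum>j\<in>UNIV. \<Sum>k. A $ i $ j * (q ^ k * x k j))"
      unfolding w_def by (simp add: suminf_mult[OF summable])
    also have "\<dots> = (\<Sum>k. \<Sum>j\<in>UNIV. A $ i $ j * (q ^ k * x k j))"
      by (rule suminf_sum[symmetric]) (intro summable_mult summable)
    \<comment> \<open>\<open>A\<close> sends \<open>x k\<close> to \<open>x (Suc k) / r\<close>, so
      the series moves up by one index; compared with \<open>w\<close> it only lacks the head
      1.\<close>
    also have "\<dots> = (\<Sum>k. 1 / (q * r) * (q ^ Suc k * x (Suc k) i))"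
      using q r by (intro suminf_cong) (simp add: x_Suc sum_distrib_left field_simps)
    also have "\<dots> = 1 / (q * r) * (\<Sum>k. q ^ Suc k * x (Suc k) i)"
      by (rule suminf_mult) (use summable_Suc_iff[of "\<lambda>k. q ^ k * x k i"] summable in blast)
    also have "\<dots> \<le> 1 / (q * r) * w i"
      unfolding w_split[of i] using q r by (intro mult_left_mono) auto
    finally show ?thesis .
  qed
  moreover have "0 < 1 / (q * r)" "1 / (q * r) < 1"
    using q r by (auto simp: divide_simps)
  ultimately show thesis using that by blast
qed

section \<open>Convolution of nonnegative kernels\<close>

lemma bounded_linear_axis: "bounded_linear (axis k :: 'a::euclidean_space \<Rightarrow> 'a ^ 'n)"
  unfolding linear_conv_bounded_linear[symmetric]
  by (rule linearI) (simp_all add: Finite_Cartesian_Product.vec_eq_iff axis_def)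

lemma integrable_vec_iff:
  fixes f :: "'b \<Rightarrow> 'a::euclidean_space ^ 'n"
  shows "integrable M f \<longleftrightarrow> (\<forall>k. integrable M (\<lambda>x. f x $ k))"
proof
  assume "integrable M f"
  then show "\<forall>k. integrable M (\<lambda>x. f x $ k)"
    using integrable_bounded_linear[OF bounded_linear_vec_nth] by blast
next
  assume *: "\<forall>k. integrable M (\<lambda>x. f x $ k)"
  have "f x $ i = (\<Sum>k\<in>UNIV. axis k (f x $ k)) $ i" for x i
    by (simp add: axis_def)
  then have "f = (\<lambda>x. \<Sum>k\<in>UNIV. axis k (f x $ k))"
    by (intro ext iffD2[OF Finite_Cartesian_Product.vec_eq_iff] allI)
  moreover have "integrable M (\<lambda>x. \<Sum>k\<in>UNIV. axis k (f x $ k))"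
    using * by (intro Bochner_Integration.integrable_sum integrable_bounded_linear[OF bounded_linear_axis]) auto
  ultimately show "integrable M f" by simp
qed

lemma integral_vec_nth:
  fixes f :: "'b \<Rightarrow> 'a::euclidean_space ^ 'n"
  assumes "integrable M f"
  shows "integral\<^sup>L M f $ k = (\<integral>x. f x $ k \<partial>M)"
  using integral_bounded_linear[OF bounded_linear_vec_nth assms, of k] by simp

section \<open>Tonelli's theorem for scalar convolutions\<close>

lemma AE_lborel_affine:
  fixes P :: "real \<Rightarrow> bool"
  assumes "AE x in lborel. P x" "c \<noteq> 0"
  shows "AE x in lborel. P (t + c * x)"
proof -
  \<comment> \<open>\<open>P\<close> is arbitrary, so its exceptional set is first enlarged to a
    Borel null set, to which the affine change of variables applies.\<close>
  obtain N where N: "{x \<in> space lborel. \<not> P x} \<subseteq> N" "emeasure lborel N = 0" "N \<in> sets lborel"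
    using AE_E[OF assms(1)] by blast
  then have "AE x in lborel. x \<notin> N"
    by (intro AE_not_in) (auto simp: null_sets_def)
  moreover have "Measurable.pred borel (\<lambda>x. x \<notin> N)"
    using N by simp
  ultimately have "AE x in lborel. t + c * x \<notin> N"
    using AE_borel_affine[OF assms(2), of "\<lambda>x. x \<notin> N" t] by simp
  then show ?thesis
    by eventually_elim (use N in auto)
qed

text \<open>Tonelli, then the translation \<open>t = s + r\<close>. The weight \<open>w\<close>
  stays general because \<open>w = 1\<close> computes masses and \<open>w = sqrt\<close> computes
  the square-root moments.\<close>

lemma nn_integral_convolution_lborel:
  fixes f h w :: "real \<Rightarrow> ennreal"
  assumes [measurable]: "f \<in> borel_measurable borel" "h \<in> borel_measurable borel" "w \<in> borel_measurable borel"
  shows "(\<integral>\<^sup>+t. w t * (\<integral>\<^sup>+s. f (t - s) * h s \<partial>lborel) \<partial>lborel) =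
         (\<integral>\<^sup>+s. (\<integral>\<^sup>+r. w (s + r) * f r \<partial>lborel) * h s \<partial>lborel)"
proof -
  have "(\<integral>\<^sup>+t. w t * (\<integral>\<^sup>+s. f (t - s) * h s \<partial>lborel) \<partial>lborel) =
      (\<integral>\<^sup>+t. (\<integral>\<^sup>+s. w t * (f (t - s) * h s) \<partial>lborel) \<partial>lborel)"
    by (intro nn_integral_cong nn_integral_cmult[symmetric]) simp
  also have "\<dots> = (\<integral>\<^sup>+s. (\<integral>\<^sup>+t. w t * (f (t - s) * h s) \<partial>lborel) \<partial>lborel)"
    by (rule lborel_pair.Fubini') simp
  also have "\<dots> = (\<integral>\<^sup>+s. (\<integral>\<^sup>+r. w (s + r) * f r \<partial>lborel) * h s \<partial>lborel)"
  proof (rule nn_integral_cong)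
    fix s
    have "(\<integral>\<^sup>+t. w t * (f (t - s) * h s) \<partial>lborel) = (\<integral>\<^sup>+r. w (s + r) * f r * h s \<partial>lborel)"
      by (subst nn_integral_real_affine[where c = 1 and t = s]) (auto simp: mult.assoc)
    also have "\<dots> = (\<integral>\<^sup>+r. w (s + r) * f r \<partial>lborel) * h s"
      by (rule nn_integral_multc) simp
    finally show "(\<integral>\<^sup>+t. w t * (f (t - s) * h s) \<partial>lborel) = (\<integral>\<^sup>+r. w (s + r) * f r \<partial>lborel) * h s" .
  qed
  finally show ?thesis .
qed

text \<open>For Lebesgue measurable \<open>f\<close> and \<open>h\<close>, joint measurability of
  \<open>f (t - s) h s\<close> is obtained by passing to Borel representatives. Reflection and
  translation preserve null sets, so the inner integral is unchanged for every \<open>t\<close>, not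
  merely for almost every one; hence it is even a Borel function of \<open>t\<close>.\<close>

lemma
  fixes f h w :: "real \<Rightarrow> ennreal"
  assumes f: "f \<in> borel_measurable lebesgue" and h: "h \<in> borel_measurable lebesgue"
  shows borel_measurable_nn_convolution:
      "(\<lambda>t. \<integral>\<^sup>+s. f (t - s) * h s \<partial>lebesgue) \<in> borel_measurable borel" (is ?th1)
    and nn_integral_convolution:
      "w \<in> borel_measurable borel \<Longrightarrow>
       (\<integral>\<^sup>+t. w t * (\<integral>\<^sup>+s. f (t - s) * h s \<partial>lebesgue) \<partial>lebesgue) =
       (\<integral>\<^sup>+s. (\<integral>\<^sup>+r. w (s + r) * f r \<partial>lebesgue) * h s \<partial>lebesgue)" (is "_ \<Longrightarrow> ?th2")
proof -
  obtain f' where f'[measurable]: "f' \<in> borel_measurable borel" and ff': "AE x in lborel. f x = f' x"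
    using completion_ex_borel_measurable[OF f] by auto
  obtain h' where h'[measurable]: "h' \<in> borel_measurable borel" and hh': "AE x in lborel. h x = h' x"
    using completion_ex_borel_measurable[OF h] by auto
  have eq: "(\<integral>\<^sup>+s. f (t - s) * h s \<partial>lebesgue) = (\<integral>\<^sup>+s. f' (t - s) * h' s \<partial>lborel)" for t
  proof -
    have "AE s in lborel. f (t - s) = f' (t - s)"
      using AE_lborel_affine[OF ff', of "-1" t] by simp
    then have "AE s in lborel. f (t - s) * h s = f' (t - s) * h' s"
      using hh' by eventually_elim simp
    then show ?thesis
      unfolding nn_integral_completion by (rule nn_integral_cong_AE)
  qed
  show ?th1 unfolding eq by measurable
  assume w[measurable]: "w \<in> borel_measurable borel"
  have "(\<integral>\<^sup>+r. w (s + r) * f r \<partial>lborel) = (\<integral>\<^sup>+r. w (s + r) * f' r \<partial>lborel)" for s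
  proof (rule nn_integral_cong_AE)
    show "AE r in lborel. w (s + r) * f r = w (s + r) * f' r"
      using ff' by eventually_elim simp
  qed
  moreover have "(\<integral>\<^sup>+s. (\<integral>\<^sup>+r. w (s + r) * f' r \<partial>lborel) * h s \<partial>lborel) =
      (\<integral>\<^sup>+s. (\<integral>\<^sup>+r. w (s + r) * f' r \<partial>lborel) * h' s \<partial>lborel)"
  proof (rule nn_integral_cong_AE)
    show "AE s in lborel. (\<integral>\<^sup>+r. w (s + r) * f' r \<partial>lborel) * h s = (\<integral>\<^sup>+r. w (s + r) * f' r \<partial>lborel) * h' s"
      using hh' by eventually_elim simp
  qed
  ultimately show ?th2
    unfolding eq unfolding nn_integral_completion nn_integral_convolution_lborel[OF f' h' w] by simp
qed

lemma lebesgue_measurable_reflect: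
  assumes "f \<in> borel_measurable lebesgue"
  shows "(\<lambda>s::real. f (t - s)) \<in> borel_measurable lebesgue"
proof -
  have "(\<lambda>s::real. t + (-1) * s) \<in> lebesgue \<rightarrow>\<^sub>M lebesgue"
    using lebesgue_affine_measurable[where c = "\<lambda>_. -1::real" and t = t] by simp
  from measurable_compose[OF this assms] show ?thesis by simp
qed

section \<open>Nonnegative matrix kernels and their convolution\<close>

text \<open>Vanishing on the negative half-line turns the integral over \<open>{0..t}\<close> in
  \<open>conv\<close> into one over the whole line. Sign and support are pointwise conditions, which
  \<open>conv\<close> preserves at every time.\<close>

definition nonneg_kernel :: "(real \<Rightarrow> real ^ 'p ^ 'p) \<Rightarrow> bool" where
  "nonneg_kernel f \<longleftrightarrow> integrable lebesgue f \<and> (\<forall>t k l. 0 \<le> f t $ k $ l) \<and> (\<forall>t<0. f t = 0)"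

text \<open>Elsewhere \<open>conv\<close> may take the value 0 that the Bochner integral assigns to
  non-integrable functions, so entry formulas and comparisons are stated at these times
  only.\<close>

definition conv_defined :: "(real \<Rightarrow> real ^ 'p ^ 'p) \<Rightarrow> (real \<Rightarrow> real ^ 'p ^ 'p) \<Rightarrow> real \<Rightarrow> bool" where
  "conv_defined f h t \<longleftrightarrow> (\<forall>k j l. integrable lebesgue (\<lambda>s. f (t - s) $ k $ j * h s $ j $ l))"

lemma nonneg_kernel_entry:
  assumes "nonneg_kernel f"
  shows "integrable lebesgue (\<lambda>t. f t $ k $ l)" "0 \<le> f t $ k $ l" "t < 0 \<Longrightarrow> f t = 0"
    "(\<lambda>t. f t $ k $ l) \<in> borel_measurable lebesgue"
  using assms by (auto simp: nonneg_kernel_def integrable_vec_iff)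

lemma nn_integral_scalar_convolution_entry:
  assumes "nonneg_kernel f" "nonneg_kernel h" and w: "w \<in> borel_measurable borel"
  shows "(\<integral>\<^sup>+t. w t * (\<integral>\<^sup>+s. ennreal (f (t - s) $ k $ j * h s $ j $ l) \<partial>lebesgue) \<partial>lebesgue) =
         (\<integral>\<^sup>+s. (\<integral>\<^sup>+r. w (s + r) * ennreal (f r $ k $ j) \<partial>lebesgue) * ennreal (h s $ j $ l) \<partial>lebesgue)"
  using nn_integral_convolution[of "\<lambda>s. ennreal (f s $ k $ j)" "\<lambda>s. ennreal (h s $ j $ l)" w]
    nonneg_kernel_entry[OF assms(1)] nonneg_kernel_entry[OF assms(2)] w
  by (simp add: ennreal_mult)

text \<open>By Tonelli with weight 1, the scalar convolutions have total integral equal to a product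
  of two finite masses, so they are finite almost everywhere.\<close>

lemma AE_conv_defined:
  assumes f: "nonneg_kernel f" and h: "nonneg_kernel h"
  shows "AE t in lebesgue. conv_defined f h t"
proof -
  note fE = nonneg_kernel_entry[OF f] and hE = nonneg_kernel_entry[OF h]
  have "AE t in lebesgue. integrable lebesgue (\<lambda>s. f (t - s) $ k $ j * h s $ j $ l)" for k j l
  proof -
    let ?F = "\<lambda>t. \<integral>\<^sup>+s. ennreal (f (t - s) $ k $ j * h s $ j $ l) \<partial>lebesgue"
    have meas: "?F \<in> borel_measurable borel"
      using borel_measurable_nn_convolution[of "\<lambda>s. ennreal (f s $ k $ j)" "\<lambda>s. ennreal (h s $ j $ l)"] fE hE
      by (simp add: ennreal_mult)
    have "(\<integral>\<^sup>+t. ?F t \<partial>lebesgue) = 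
       (\<integral>\<^sup>+s. (\<integral>\<^sup>+r. ennreal (f r $ k $ j) \<partial>lebesgue) * ennreal (h s $ j $ l) \<partial>lebesgue)"
      using nn_integral_scalar_convolution_entry[OF f h, of "\<lambda>_. 1"] by simp
    also have "\<dots> = (\<integral>\<^sup>+r. ennreal (f r $ k $ j) \<partial>lebesgue) * (\<integral>\<^sup>+s. ennreal (h s $ j $ l) \<partial>lebesgue)"
      using hE by (intro nn_integral_cmult) simp
    also have "\<dots> < \<infinity>"
      using fE(1,2) hE(1,2) by (simp add: nn_integral_eq_integral ennreal_mult_less_top)
    finally have "AE t in lebesgue. ?F t \<noteq> \<infinity>"
      using meas by (intro nn_integral_noteq_infinite) (auto simp: measurable_completion)
    then show ?thesis
    proof eventually_elim
      case (elim t)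
      have "(\<lambda>s. f (t - s) $ k $ j * h s $ j $ l) \<in> borel_measurable lebesgue"
        using hE(4) lebesgue_measurable_reflect[OF fE(4)] by (intro borel_measurable_times)
      then show ?case using elim fE hE
        by (intro integrableI_nonneg) (auto simp: top.not_eq_extremum)
    qed
  qed
  then show ?thesis
    unfolding conv_defined_def by (simp add: AE_all_countable)
qed

lemma conv_eq_whole_line:
  assumes "nonneg_kernel f" "nonneg_kernel h"
  shows "conv f h t = (\<integral>s. f (t - s) ** h s \<partial>lebesgue)"
  unfolding conv_def set_lebesgue_integral_def
  using assms by (intro Bochner_Integration.integral_cong) (auto simp: indicator_def nonneg_kernel_def)

lemma conv_defined_imp_integrable:
  assumes "conv_defined f h t"
  shows "integrable lebesgue (\<lambda>s. f (t - s) ** h s)"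
  using assms unfolding conv_defined_def integrable_vec_iff matrix_matrix_mult_def
  by (auto intro!: Bochner_Integration.integrable_sum)

lemma conv_entry:
  assumes "nonneg_kernel f" "nonneg_kernel h" "conv_defined f h t"
  shows "conv f h t $ k $ l = (\<Sum>j\<in>UNIV. \<integral>s. f (t - s) $ k $ j * h s $ j $ l \<partial>lebesgue)"
proof -
  note int = conv_defined_imp_integrable[OF assms(3)]
  have "conv f h t $ k $ l = (\<integral>s. (f (t - s) ** h s) $ k $ l \<partial>lebesgue)"
    using int unfolding conv_eq_whole_line[OF assms(1,2)]
    by (simp add: integral_vec_nth integrable_vec_iff)
  then show ?thesis
    using assms(3) by (simp add: matrix_matrix_mult_def conv_defined_def)
qed

lemma conv_nonneg:
  assumes "nonneg_kernel f" "nonneg_kernel h"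
  shows "0 \<le> conv f h t $ k $ l"
proof (cases "integrable lebesgue (\<lambda>s. f (t - s) ** h s)")
  case True
  then have "conv f h t $ k $ l = (\<integral>s. (f (t - s) ** h s) $ k $ l \<partial>lebesgue)"
    unfolding conv_eq_whole_line[OF assms] by (simp add: integral_vec_nth integrable_vec_iff)
  also have "\<dots> \<ge> 0"
    using assms by (intro Bochner_Integration.integral_nonneg)
      (auto simp: matrix_matrix_mult_def nonneg_kernel_def intro!: sum_nonneg)
  finally show ?thesis .
next
  \<comment> \<open>The default value 0 of the integral is nonnegative too, so the bound holds at
    every \<open>t\<close>.\<close>
  case False
  then show ?thesis by (simp add: conv_eq_whole_line[OF assms] not_integrable_integral_eq)
qed

lemma ennreal_conv_entry:
  assumes "nonneg_kernel f" "nonneg_kernel h" "conv_defined f h t"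
  shows "ennreal (conv f h t $ k $ l) =
    (\<Sum>j\<in>UNIV. \<integral>\<^sup>+s. ennreal (f (t - s) $ k $ j * h s $ j $ l) \<partial>lebesgue)"
proof -
  have nonneg: "0 \<le> f (t - s) $ k $ j * h s $ j $ l" for j s
    using nonneg_kernel_entry(2)[OF assms(1)] nonneg_kernel_entry(2)[OF assms(2)] by simp
  have "ennreal (conv f h t $ k $ l) = (\<Sum>j\<in>UNIV. ennreal (\<integral>s. f (t - s) $ k $ j * h s $ j $ l \<partial>lebesgue))"
    unfolding conv_entry[OF assms] using nonneg
    by (intro sum_ennreal[symmetric] Bochner_Integration.integral_nonneg)
  also have "\<dots> = (\<Sum>j\<in>UNIV. \<integral>\<^sup>+s. ennreal (f (t - s) $ k $ j * h s $ j $ l) \<partial>lebesgue)"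
    using assms(3) nonneg unfolding conv_defined_def
    by (intro sum.cong refl nn_integral_eq_integral[symmetric]) auto
  finally show ?thesis .
qed

lemma nn_integral_conv:
  assumes f: "nonneg_kernel f" and h: "nonneg_kernel h" and w[measurable]: "w \<in> borel_measurable borel"
  shows "(\<integral>\<^sup>+t. w t * ennreal (conv f h t $ k $ l) \<partial>lebesgue) =
    (\<Sum>j\<in>UNIV. \<integral>\<^sup>+s. (\<integral>\<^sup>+r. w (s + r) * ennreal (f r $ k $ j) \<partial>lebesgue) * ennreal (h s $ j $ l) \<partial>lebesgue)"
proof -
  note fE = nonneg_kernel_entry[OF f] and hE = nonneg_kernel_entry[OF h]
  let ?F = "\<lambda>j t. \<integral>\<^sup>+s. ennreal (f (t - s) $ k $ j * h s $ j $ l) \<partial>lebesgue"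
  have meas: "?F j \<in> borel_measurable borel" for j
    using borel_measurable_nn_convolution[of "\<lambda>s. ennreal (f s $ k $ j)" "\<lambda>s. ennreal (h s $ j $ l)"] fE hE
    by (simp add: ennreal_mult)
  have "(\<integral>\<^sup>+t. w t * ennreal (conv f h t $ k $ l) \<partial>lebesgue) = (\<integral>\<^sup>+t. (\<Sum>j\<in>UNIV. w t * ?F j t) \<partial>lebesgue)"
    using AE_conv_defined[OF f h]
  proof (intro nn_integral_cong_AE, eventually_elim)
    case (elim t)
    then show ?case by (simp only: ennreal_conv_entry[OF f h] sum_distrib_left)
  qed
  also have "\<dots> = (\<Sum>j\<in>UNIV. \<integral>\<^sup>+t. w t * ?F j t \<partial>lebesgue)"
    using meas by (intro nn_integral_sum measurable_completion) simp
  finally show ?thesis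
    using nn_integral_scalar_convolution_entry[OF f h w] by simp
qed

lemma nonneg_kernel_conv:
  assumes f: "nonneg_kernel f" and h: "nonneg_kernel h"
  shows "nonneg_kernel (conv f h)"
  unfolding nonneg_kernel_def
proof (intro conjI allI impI)
  note fE = nonneg_kernel_entry[OF f] and hE = nonneg_kernel_entry[OF h]
  show "0 \<le> conv f h t $ k $ l" for t k l by (rule conv_nonneg[OF f h])
  show "conv f h t = 0" if "t < 0" for t
    using that by (simp add: conv_def set_lebesgue_integral_def)
  have "integrable lebesgue (\<lambda>t. conv f h t $ k $ l)" for k l
  proof (rule integrableI_nonneg)
    \<comment> \<open>Measurability comes from a Borel function: the sum of the nonnegative
      integrals equals the entry of \<open>conv\<close> almost everywhere, and Lebesgue measure is
      complete.\<close>
    have "(\<lambda>t. \<Sum>j\<in>UNIV. \<integral>\<^sup>+s. ennreal (f (t - s) $ k $ j * h s $ j $ l) \<partial>lebesgue) \<in> borel_measurable borel"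
    proof (rule borel_measurable_sum)
      show "(\<lambda>t. \<integral>\<^sup>+s. ennreal (f (t - s) $ k $ j * h s $ j $ l) \<partial>lebesgue) \<in> borel_measurable borel" for j
        using borel_measurable_nn_convolution[of "\<lambda>s. ennreal (f s $ k $ j)" "\<lambda>s. ennreal (h s $ j $ l)"] fE hE
        by (simp add: ennreal_mult)
    qed
    then have "(\<lambda>t. enn2real (\<Sum>j\<in>UNIV. \<integral>\<^sup>+s. ennreal (f (t - s) $ k $ j * h s $ j $ l) \<partial>lebesgue)) \<in> borel_measurable lebesgue"
      by (simp add: measurable_completion)
    then show "(\<lambda>t. conv f h t $ k $ l) \<in> borel_measurable lebesgue"
    proof (rule borel_measurable_AE)
      show "AE t in lebesgue. enn2real (\<Sum>j\<in>UNIV. \<integral>\<^sup>+s. ennreal (f (t - s) $ k $ j * h s $ j $ l) \<partial>lebesgue) = conv f h t $ k $ l"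
        using AE_conv_defined[OF f h]
      proof eventually_elim
        case (elim t)
        then show ?case
          by (simp only: ennreal_conv_entry[OF f h, symmetric] enn2real_ennreal[OF conv_nonneg[OF f h]])
      qed
    qed
    show "AE t in lebesgue. 0 \<le> conv f h t $ k $ l" by (simp add: conv_nonneg[OF f h])
    have "(\<integral>\<^sup>+t. ennreal (conv f h t $ k $ l) \<partial>lebesgue) =
      (\<Sum>j\<in>UNIV. (\<integral>\<^sup>+r. ennreal (f r $ k $ j) \<partial>lebesgue) * (\<integral>\<^sup>+s. ennreal (h s $ j $ l) \<partial>lebesgue))"
      using nn_integral_conv[OF f h, of "\<lambda>_. 1" k l] hE by (simp add: nn_integral_cmult)
    also have "\<dots> < \<infinity>"
      using fE(1,2) hE(1,2) by (simp add: nn_integral_eq_integral ennreal_mult_less_top)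
    finally show "(\<integral>\<^sup>+t. ennreal (conv f h t $ k $ l) \<partial>lebesgue) < \<infinity>" .
  qed
  then show "integrable lebesgue (conv f h)" by (simp add: integrable_vec_iff)
qed

text \<open>Since \<open>f (t - s)\<close> vanishes for \<open>s > t\<close>, the hypothesis
  concerns only \<open>s \<le> t\<close>, so \<open>c\<close> may depend on the outer time
  \<open>t\<close>. Taking \<open>h2 = 0\<close> gives monotonicity of the convolution.\<close>

lemma conv_diff_bound:
  assumes f: "nonneg_kernel f" and h: "nonneg_kernel h1" "nonneg_kernel h2" "nonneg_kernel h"
    and def: "conv_defined f h1 t" "conv_defined f h2 t" "conv_defined f h t"
    and le: "AE s in lebesgue. s \<le> t \<longrightarrow> (\<forall>j. \<bar>h1 s $ j $ l - h2 s $ j $ l\<bar> \<le> c * h s $ j $ l)"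
  shows "\<bar>conv f h1 t $ k $ l - conv f h2 t $ k $ l\<bar> \<le> c * conv f h t $ k $ l"
proof -
  note fE = nonneg_kernel_entry[OF f]
  note d = def[unfolded conv_defined_def, rule_format]
  have "\<bar>(\<integral>s. f (t - s) $ k $ j * h1 s $ j $ l \<partial>lebesgue) - (\<integral>s. f (t - s) $ k $ j * h2 s $ j $ l \<partial>lebesgue)\<bar>
      \<le> c * (\<integral>s. f (t - s) $ k $ j * h s $ j $ l \<partial>lebesgue)" for j
  proof -
    have "\<bar>(\<integral>s. f (t - s) $ k $ j * h1 s $ j $ l \<partial>lebesgue) - (\<integral>s. f (t - s) $ k $ j * h2 s $ j $ l \<partial>lebesgue)\<bar>
      = \<bar>\<integral>s. f (t - s) $ k $ j * h1 s $ j $ l - f (t - s) $ k $ j * h2 s $ j $ l \<partial>lebesgue\<bar>"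
      using d by simp
    also have "\<dots> \<le> (\<integral>s. \<bar>f (t - s) $ k $ j * h1 s $ j $ l - f (t - s) $ k $ j * h2 s $ j $ l\<bar> \<partial>lebesgue)"
      by (rule integral_abs_bound)
    also have "\<dots> \<le> (\<integral>s. c * (f (t - s) $ k $ j * h s $ j $ l) \<partial>lebesgue)"
    proof (rule integral_mono_AE)
      show "AE s in lebesgue. \<bar>f (t - s) $ k $ j * h1 s $ j $ l - f (t - s) $ k $ j * h2 s $ j $ l\<bar>
          \<le> c * (f (t - s) $ k $ j * h s $ j $ l)"
        using le
      proof eventually_elim
        case (elim s)
        show ?case
        proof (cases "s \<le> t")
          case True
          have "\<bar>f (t - s) $ k $ j * h1 s $ j $ l - f (t - s) $ k $ j * h2 s $ j $ l\<bar> =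
              f (t - s) $ k $ j * \<bar>h1 s $ j $ l - h2 s $ j $ l\<bar>"
            using fE(2) by (simp add: abs_mult flip: right_diff_distrib)
          also have "\<dots> \<le> f (t - s) $ k $ j * (c * h s $ j $ l)"
            using elim True fE(2) by (intro mult_left_mono) auto
          finally show ?thesis by (simp add: mult_ac)
        qed (use fE(3) in simp)
      qed
    qed (use d in auto)
    finally show ?thesis using d by simp
  qed
  then have "\<bar>\<Sum>j\<in>UNIV. (\<integral>s. f (t - s) $ k $ j * h1 s $ j $ l \<partial>lebesgue) - (\<integral>s. f (t - s) $ k $ j * h2 s $ j $ l \<partial>lebesgue)\<bar>
      \<le> (\<Sum>j\<in>UNIV. c * (\<integral>s. f (t - s) $ k $ j * h s $ j $ l \<partial>lebesgue))"
    by (intro order_trans[OF sum_abs] sum_mono)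
  then show ?thesis
    using assms by (simp add: conv_entry sum_subtractf sum_distrib_left)
qed

lemma nonneg_kernel_scale:
  assumes f: "nonneg_kernel f" and \<gamma>: "\<gamma> \<in> borel_measurable lebesgue" "\<And>v. 0 \<le> \<gamma> v" "\<And>v. \<gamma> v \<le> G"
  shows "nonneg_kernel (\<lambda>v. \<gamma> v *\<^sub>R f v)"
proof -
  have "integrable lebesgue (\<lambda>v. \<gamma> v *\<^sub>R f v)"
  proof (rule Bochner_Integration.integrable_bound)
    show "integrable lebesgue (\<lambda>v. G *\<^sub>R f v)" using f by (auto simp: nonneg_kernel_def)
    show "(\<lambda>v. \<gamma> v *\<^sub>R f v) \<in> borel_measurable lebesgue"
      using f \<gamma> by (auto simp: nonneg_kernel_def)
    show "AE v in lebesgue. norm (\<gamma> v *\<^sub>R f v) \<le> norm (G *\<^sub>R f v)"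
      using \<gamma>(2,3) order_trans by (fastforce intro!: AE_I2 mult_right_mono)
  qed
  then show ?thesis
    using f \<gamma>(2) by (auto simp: nonneg_kernel_def)
qed

section \<open>Iterates with a weight\<close>

lemma nonneg_kernel_zero: "nonneg_kernel (\<lambda>_. 0)"
  by (simp add: nonneg_kernel_def)

lemma conv_zero: "conv f (\<lambda>_. 0) = (\<lambda>_. 0)"
  by (simp add: conv_def fun_eq_iff)

lemma conv_scaleR: "conv f (\<lambda>v. c *\<^sub>R h v) t = c *\<^sub>R conv f h t"
  by (simp add: conv_def matrix_scalar_ac flip: scalar_matrix_assoc)

section \<open>Masses and square-root moments of convolutions\<close>

lemma integral_conv:
  assumes f: "nonneg_kernel f" and h: "nonneg_kernel h"
  shows "(\<integral>t. conv f h t $ k $ l \<partial>lebesgue) =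
    (\<Sum>j\<in>UNIV. (\<integral>t. f t $ k $ j \<partial>lebesgue) * (\<integral>t. h t $ j $ l \<partial>lebesgue))"
proof -
  note fE = nonneg_kernel_entry[OF f] and hE = nonneg_kernel_entry[OF h]
    and cE = nonneg_kernel_entry[OF nonneg_kernel_conv[OF f h]]
  have I_nonneg: "0 \<le> (\<integral>t. u t $ k $ l \<partial>lebesgue)" if "nonneg_kernel u" for u :: "real \<Rightarrow> real ^ 'a ^ 'a" and k l
    using nonneg_kernel_entry[OF that] by (intro Bochner_Integration.integral_nonneg) auto
  have "ennreal (\<integral>t. conv f h t $ k $ l \<partial>lebesgue) = (\<integral>\<^sup>+t. 1 * ennreal (conv f h t $ k $ l) \<partial>lebesgue)"
    using cE by (simp add: nn_integral_eq_integral)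
  also have "\<dots> = (\<Sum>j\<in>UNIV. ennreal ((\<integral>t. f t $ k $ j \<partial>lebesgue) * (\<integral>t. h t $ j $ l \<partial>lebesgue)))"
    unfolding nn_integral_conv[OF f h borel_measurable_const]
    using fE hE I_nonneg[OF f] I_nonneg[OF h]
    by (simp add: nn_integral_eq_integral nn_integral_cmult ennreal_mult)
  also have "\<dots> = ennreal (\<Sum>j\<in>UNIV. (\<integral>t. f t $ k $ j \<partial>lebesgue) * (\<integral>t. h t $ j $ l \<partial>lebesgue))"
    using I_nonneg[OF f] I_nonneg[OF h] by (intro sum_ennreal) simp
  finally show ?thesis
    using I_nonneg[OF f] I_nonneg[OF h] I_nonneg[OF nonneg_kernel_conv[OF f h]]
    by (simp add: sum_nonneg)
qed

text \<open>In HOL \<open>sqrt\<close> is negative on negative arguments. For a kernel supported on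
  the nonnegative half-line this is harmless, and the integral is the usual moment of order one
  half.\<close>

definition sqrt_moment :: "(real \<Rightarrow> real ^ 'p ^ 'p) \<Rightarrow> 'p \<Rightarrow> 'p \<Rightarrow> real" where
  "sqrt_moment f k l = (\<integral>t. sqrt t * f t $ k $ l \<partial>lebesgue)"

definition has_sqrt_moments :: "(real \<Rightarrow> real ^ 'p ^ 'p) \<Rightarrow> bool" where
  "has_sqrt_moments f \<longleftrightarrow> (\<forall>k l. integrable lebesgue (\<lambda>t. sqrt t * f t $ k $ l))"

lemma sqrt_mult_entry_nonneg:
  assumes "nonneg_kernel f"
  shows "0 \<le> sqrt t * f t $ k $ l"
  using nonneg_kernel_entry(2,3)[OF assms] by (cases "t < 0") auto

text \<open>Tonelli with weight \<open>sqrt\<close>, combined with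
  \<open>sqrt (s + r) \<le> sqrt s + sqrt r\<close>: the moment of a convolution obeys a product
  rule, as an inequality. The same finite bound yields integrability.\<close>

lemma sqrt_moment_conv:
  assumes f: "nonneg_kernel f" "has_sqrt_moments f" and h: "nonneg_kernel h" "has_sqrt_moments h"
  shows "has_sqrt_moments (conv f h)" (is ?th1)
    and "sqrt_moment (conv f h) k l \<le>
      (\<Sum>j\<in>UNIV. sqrt_moment f k j * (\<integral>t. h t $ j $ l \<partial>lebesgue) +
                (\<integral>t. f t $ k $ j \<partial>lebesgue) * sqrt_moment h j l)" (is ?th2)
proof -
  note fE = nonneg_kernel_entry[OF f(1)] and hE = nonneg_kernel_entry[OF h(1)]
    and cE = nonneg_kernel_entry[OF nonneg_kernel_conv[OF f(1) h(1)]]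
  note fS = f(2)[unfolded has_sqrt_moments_def, rule_format] and hS = h(2)[unfolded has_sqrt_moments_def, rule_format]
  note nn = sqrt_mult_entry_nonneg[OF f(1)] sqrt_mult_entry_nonneg[OF h(1)]
    sqrt_mult_entry_nonneg[OF nonneg_kernel_conv[OF f(1) h(1)]]
  have I_nonneg: "0 \<le> (\<integral>t. f t $ k $ l \<partial>lebesgue)" "0 \<le> (\<integral>t. h t $ k $ l \<partial>lebesgue)"
    "0 \<le> sqrt_moment f k l" "0 \<le> sqrt_moment h k l" for k l
    unfolding sqrt_moment_def using fE(2) hE(2) nn by (auto intro!: Bochner_Integration.integral_nonneg)
  let ?R = "\<lambda>k l. \<Sum>j\<in>UNIV. sqrt_moment f k j * (\<integral>t. h t $ j $ l \<partial>lebesgue) +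
                (\<integral>t. f t $ k $ j \<partial>lebesgue) * sqrt_moment h j l"
  have bound: "(\<integral>\<^sup>+t. ennreal (sqrt t * conv f h t $ k $ l) \<partial>lebesgue) \<le> ennreal (?R k l)" for k l
  proof -
    have inner: "(\<integral>\<^sup>+r. ennreal (sqrt (s + r)) * ennreal (f r $ k $ j) \<partial>lebesgue) * ennreal (h s $ j $ l) \<le>
        ennreal (sqrt_moment f k j * h s $ j $ l + (\<integral>t. f t $ k $ j \<partial>lebesgue) * (sqrt s * h s $ j $ l))" for s j
    proof (cases "s < 0")
      case True
      then show ?thesis using hE(3) by simp
    next
      case False
      have "(\<integral>\<^sup>+r. ennreal (sqrt (s + r)) * ennreal (f r $ k $ j) \<partial>lebesgue) \<le>
          (\<integral>\<^sup>+r. ennreal (sqrt r * f r $ k $ j + sqrt s * f r $ k $ j) \<partial>lebesgue)"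
      proof (rule nn_integral_mono)
        fix r
        show "ennreal (sqrt (s + r)) * ennreal (f r $ k $ j) \<le> ennreal (sqrt r * f r $ k $ j + sqrt s * f r $ k $ j)"
        proof (cases "r < 0")
          case False
          then have "sqrt (s + r) * f r $ k $ j \<le> (sqrt s + sqrt r) * f r $ k $ j"
            using \<open>\<not> s < 0\<close> fE(2) by (intro mult_right_mono sqrt_add_le_add_sqrt) auto
          then have "ennreal (sqrt (s + r) * f r $ k $ j) \<le> ennreal (sqrt r * f r $ k $ j + sqrt s * f r $ k $ j)"
            by (intro ennreal_leI) (simp add: algebra_simps)
          then show ?thesis
            using False \<open>\<not> s < 0\<close> fE(2) by (simp add: ennreal_mult)
        qed (use fE(3) in simp)
      qed
      also have "\<dots> = ennreal (sqrt_moment f k j + sqrt s * (\<integral>t. f t $ k $ j \<partial>lebesgue))"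
        using fE fS nn False by (subst nn_integral_eq_integral) (auto simp: sqrt_moment_def)
      finally have "(\<integral>\<^sup>+r. ennreal (sqrt (s + r)) * ennreal (f r $ k $ j) \<partial>lebesgue) * ennreal (h s $ j $ l) \<le>
          ennreal (sqrt_moment f k j + sqrt s * (\<integral>t. f t $ k $ j \<partial>lebesgue)) * ennreal (h s $ j $ l)"
        by (rule mult_right_mono) simp
      also have "\<dots> = ennreal (sqrt_moment f k j * h s $ j $ l + (\<integral>t. f t $ k $ j \<partial>lebesgue) * (sqrt s * h s $ j $ l))"
        using False hE(2) I_nonneg by (subst ennreal_mult[symmetric]) (auto simp: algebra_simps)
      finally show ?thesis .
    qed
    have "(\<integral>\<^sup>+t. ennreal (sqrt t * conv f h t $ k $ l) \<partial>lebesgue) = (\<integral>\<^sup>+t. ennreal (sqrt t) * ennreal (conv f h t $ k $ l) \<partial>lebesgue)"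
    proof (rule nn_integral_cong)
      show "ennreal (sqrt t * conv f h t $ k $ l) = ennreal (sqrt t) * ennreal (conv f h t $ k $ l)" for t
        using cE(2,3) by (cases "t < 0") (auto simp: ennreal_mult)
    qed
    also have "\<dots> = (\<Sum>j\<in>UNIV. \<integral>\<^sup>+s. (\<integral>\<^sup>+r. ennreal (sqrt (s + r)) * ennreal (f r $ k $ j) \<partial>lebesgue) * ennreal (h s $ j $ l) \<partial>lebesgue)"
      by (rule nn_integral_conv[OF f(1) h(1)]) simp
    also have "\<dots> \<le> (\<Sum>j\<in>UNIV. \<integral>\<^sup>+s. ennreal (sqrt_moment f k j * h s $ j $ l + (\<integral>t. f t $ k $ j \<partial>lebesgue) * (sqrt s * h s $ j $ l)) \<partial>lebesgue)"
      by (intro sum_mono nn_integral_mono inner)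
    also have "\<dots> = (\<Sum>j\<in>UNIV. ennreal (sqrt_moment f k j * (\<integral>t. h t $ j $ l \<partial>lebesgue) +
                (\<integral>t. f t $ k $ j \<partial>lebesgue) * sqrt_moment h j l))"
    proof (rule sum.cong[OF refl])
      fix j
      have "0 \<le> sqrt_moment f k j * h s $ j $ l + (\<integral>t. f t $ k $ j \<partial>lebesgue) * (sqrt s * h s $ j $ l)" for s
        by (intro add_nonneg_nonneg mult_nonneg_nonneg[OF I_nonneg(3) hE(2)]
            mult_nonneg_nonneg[OF I_nonneg(1) nn(2)])
      then show "(\<integral>\<^sup>+s. ennreal (sqrt_moment f k j * h s $ j $ l + (\<integral>t. f t $ k $ j \<partial>lebesgue) * (sqrt s * h s $ j $ l)) \<partial>lebesgue) =
        ennreal (sqrt_moment f k j * (\<integral>t. h t $ j $ l \<partial>lebesgue) +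
                (\<integral>t. f t $ k $ j \<partial>lebesgue) * sqrt_moment h j l)"
        using hE(1) hS by (subst nn_integral_eq_integral) (auto simp: sqrt_moment_def)
    qed
    also have "\<dots> = ennreal (?R k l)"
      using I_nonneg by (intro sum_ennreal) simp
    finally show ?thesis .
  qed
  show ?th1
    unfolding has_sqrt_moments_def
  proof (intro allI integrableI_nonneg)
    fix k l
    show "(\<lambda>t. sqrt t * conv f h t $ k $ l) \<in> borel_measurable lebesgue"
      by (intro borel_measurable_times cE(4) measurable_completion) simp
    show "(\<integral>\<^sup>+t. ennreal (sqrt t * conv f h t $ k $ l) \<partial>lebesgue) < \<infinity>"
      using bound[of k l] by (simp add: order_le_less_trans)
  qed (use nn in simp)
  then have "ennreal (sqrt_moment (conv f h) k l) \<le> ennreal (?R k l)"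
    using bound[of k l] nn unfolding sqrt_moment_def has_sqrt_moments_def
    by (subst nn_integral_eq_integral[symmetric]) auto
  moreover have "0 \<le> ?R k l"
    using I_nonneg by (intro sum_nonneg add_nonneg_nonneg mult_nonneg_nonneg)
  ultimately show ?th2
    by (simp only: ennreal_le_iff)
qed

section \<open>Recursion in elapsed time and comparison of weights\<close>

text \<open>Index \<open>i\<close> belongs to the power \<open>i + 1\<close>. The weight is
  evaluated at the outer time and so multiplies the convolution from outside, just as
  \<open>g (t / T)\<close> does in a Volterra product of kernels.\<close>

primrec weighted_iterate ::
  "(real \<Rightarrow> real) \<Rightarrow> (real \<Rightarrow> real ^ 'p ^ 'p) \<Rightarrow> nat \<Rightarrow> real \<Rightarrow> real ^ 'p ^ 'p" where
  "weighted_iterate \<gamma> \<phi> 0 = (\<lambda>v. \<gamma> v *\<^sub>R \<phi> v)"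
| "weighted_iterate \<gamma> \<phi> (Suc i) = (\<lambda>v. \<gamma> v *\<^sub>R conv \<phi> (weighted_iterate \<gamma> \<phi> i) v)"

lemma weighted_iterate_const:
  "weighted_iterate (\<lambda>_. c) \<phi> i = (\<lambda>v. c ^ Suc i *\<^sub>R conv_power \<phi> (Suc i) v)"
  by (induction i) (simp_all add: conv_power_def conv_scaleR)

text \<open>Causality: the value at \<open>v\<close> involves the weight on \<open>[0, v]\<close>
  only. This permits replacing \<open>g\<close>, about which nothing is known outside
  \<open>[0,1]\<close>, by an extension to the whole line.\<close>

lemma weighted_iterate_cong:
  assumes zero: "\<And>t. t < 0 \<Longrightarrow> \<phi> t = 0"
    and eq: "\<And>v. 0 \<le> v \<Longrightarrow> v \<le> V \<Longrightarrow> \<gamma> v = \<gamma>' v" and "v \<le> V"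
  shows "weighted_iterate \<gamma> \<phi> i v = weighted_iterate \<gamma>' \<phi> i v"
  using \<open>v \<le> V\<close>
proof (induction i arbitrary: v)
  case 0
  then show ?case using zero eq by (cases "v < 0") auto
next
  case (Suc i)
  have "conv \<phi> (weighted_iterate \<gamma> \<phi> i) v = conv \<phi> (weighted_iterate \<gamma>' \<phi> i) v"
    unfolding conv_def set_lebesgue_integral_def
    using Suc by (intro Bochner_Integration.integral_cong) (auto simp: indicator_def)
  moreover have "conv \<phi> (weighted_iterate \<gamma>' \<phi> i) v = 0" if "v < 0"
    using that by (simp add: conv_def set_lebesgue_integral_def)
  ultimately show ?case using eq Suc.prems by (cases "v < 0") auto
qed

text \<open>Substitute \<open>u = s + v\<close> in the Volterra product; the factor
  \<open>g (t / T)\<close> is free of \<open>u\<close> and leaves the integral. Both manipulations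
  are unconditional for Bochner integrals, so the identity holds at all \<open>t\<close> and
  \<open>s\<close>, including those where the integrals diverge.\<close>

lemma volterra_power_kernel:
  "volterra_power (kernel g \<phi> T) (Suc i) t s = weighted_iterate (\<lambda>v. g ((s + v) / T)) \<phi> i (t - s)"
proof (induction i arbitrary: t)
  case 0
  then show ?case by (simp add: volterra_power_def kernel_def)
next
  case (Suc i)
  let ?W = "weighted_iterate (\<lambda>v. g ((s + v) / T)) \<phi> i"
  have "volterra_power (kernel g \<phi> T) (Suc (Suc i)) t s =
      (\<integral>u. indicator {s..t} u *\<^sub>R (kernel g \<phi> T t u ** ?W (u - s)) \<partial>lebesgue)"
    using Suc.IH by (simp add: volterra_power_def volterra_def set_lebesgue_integral_def)
  also have "\<dots> = (\<integral>v. indicator {s..t} (s + 1 * v) *\<^sub>R (kernel g \<phi> T t (s + 1 * v) ** ?W (s + 1 * v - s)) \<partial>lebesgue)"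
    by (subst lebesgue_integral_real_affine[of 1 _ s]) simp_all
  also have "\<dots> = (\<integral>v. g (t / T) *\<^sub>R (indicator {0..t - s} v *\<^sub>R (\<phi> (t - s - v) ** ?W v)) \<partial>lebesgue)"
    by (intro Bochner_Integration.integral_cong)
      (auto simp: kernel_def indicator_def algebra_simps simp flip: scalar_matrix_assoc)
  also have "\<dots> = g (t / T) *\<^sub>R conv \<phi> ?W (t - s)"
    by (simp only: conv_def set_lebesgue_integral_def integral_scaleR_right)
  finally show ?case by simp
qed

definition bounded_weight :: "real \<Rightarrow> (real \<Rightarrow> real) \<Rightarrow> bool" where
  "bounded_weight G \<gamma> \<longleftrightarrow> \<gamma> \<in> borel_measurable lebesgue \<and> (\<forall>v. 0 \<le> \<gamma> v \<and> \<gamma> v \<le> G)"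

lemma nonneg_kernel_weighted_iterate:
  assumes "nonneg_kernel \<phi>" "bounded_weight G \<gamma>"
  shows "nonneg_kernel (weighted_iterate \<gamma> \<phi> i)"
proof (induction i)
  case 0
  show ?case using assms nonneg_kernel_scale by (auto simp: bounded_weight_def)
next
  case (Suc i)
  from nonneg_kernel_scale[OF nonneg_kernel_conv[OF assms(1) Suc], of \<gamma> G]
  show ?case using assms(2) by (auto simp: bounded_weight_def)
qed

lemma AE_conv_defined_weighted_iterate:
  assumes "nonneg_kernel \<phi>" "bounded_weight G \<gamma>"
  shows "AE v in lebesgue. conv_defined \<phi> (weighted_iterate \<gamma> \<phi> i) v"
  by (intro AE_conv_defined assms nonneg_kernel_weighted_iterate[where G = G])

text \<open>Convolution with the nonnegative \<open>\<phi>\<close> preserves order, by the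
  difference bound with one kernel equal to 0. The claim is almost everywhere because the larger
  convolution drops to the default 0 where it diverges.\<close>

lemma weighted_iterate_le:
  assumes \<phi>: "nonneg_kernel \<phi>" and \<gamma>: "bounded_weight G \<gamma>"
  shows "AE v in lebesgue. \<forall>k l. weighted_iterate \<gamma> \<phi> i v $ k $ l \<le> weighted_iterate (\<lambda>_. G) \<phi> i v $ k $ l"
proof (induction i)
  case 0
  show ?case
    using \<gamma> nonneg_kernel_entry(2)[OF \<phi>] by (intro AE_I2) (auto simp: bounded_weight_def mult_right_mono)
next
  case (Suc i)
  have G: "bounded_weight G (\<lambda>_. G)"
    using \<gamma> by (auto simp: bounded_weight_def intro: order_trans)
  note nk = nonneg_kernel_weighted_iterate[OF \<phi> \<gamma>, of i] nonneg_kernel_weighted_iterate[OF \<phi> G, of i]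
  have le: "AE s in lebesgue. s \<le> t \<longrightarrow> (\<forall>j. \<bar>weighted_iterate \<gamma> \<phi> i s $ j $ l - 0 $ j $ l\<bar> \<le> 1 * weighted_iterate (\<lambda>_. G) \<phi> i s $ j $ l)" for t l
    using Suc by eventually_elim (use nonneg_kernel_entry(2)[OF nk(1)] in auto)
  show ?case
    using AE_conv_defined_weighted_iterate[OF \<phi> \<gamma>, of i] AE_conv_defined_weighted_iterate[OF \<phi> G, of i]
      AE_conv_defined[OF \<phi> nonneg_kernel_zero]
  proof eventually_elim
    case (elim v)
    have "conv \<phi> (weighted_iterate \<gamma> \<phi> i) v $ k $ l \<le> conv \<phi> (weighted_iterate (\<lambda>_. G) \<phi> i) v $ k $ l" for k l
      using conv_diff_bound[OF \<phi> nk(1) nonneg_kernel_zero nk(2) elim(1) elim(3) elim(2) le, of k l]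
      by (simp add: conv_zero)
    moreover have "0 \<le> conv \<phi> (weighted_iterate \<gamma> \<phi> i) v $ k $ l" for k l
      by (rule conv_nonneg[OF \<phi> nk(1)])
    ultimately show ?case
      using \<gamma> by (auto simp: bounded_weight_def intro!: mult_mono intro: order_trans)
  qed
qed

text \<open>With \<open>A\<close>, \<open>A'\<close> the convolutions at the previous index,
  \<open>\<gamma> A - \<gamma>' A' = \<gamma> (A - A') + (\<gamma> - \<gamma>') A'\<close>. The
  first summand inherits \<open>Suc i\<close> copies of the relative error
  \<open>\<delta> / G\<close> from the induction hypothesis, the second adds one more.\<close>

lemma weighted_iterate_diff:
  assumes \<phi>: "nonneg_kernel \<phi>" and \<gamma>: "bounded_weight G \<gamma>" "bounded_weight G \<gamma>'" and "G > 0"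
    and diff: "\<And>v. 0 \<le> v \<Longrightarrow> \<bar>\<gamma> v - \<gamma>' v\<bar> \<le> \<delta> v"
    and mono: "\<And>v v'. 0 \<le> v \<Longrightarrow> v \<le> v' \<Longrightarrow> \<delta> v \<le> \<delta> v'"
  shows "AE v in lebesgue. \<forall>k l. \<bar>weighted_iterate \<gamma> \<phi> i v $ k $ l - weighted_iterate \<gamma>' \<phi> i v $ k $ l\<bar>
    \<le> (real (Suc i) * (\<delta> v / G)) * weighted_iterate (\<lambda>_. G) \<phi> i v $ k $ l"
proof (induction i)
  case 0
  show ?case
  proof (intro AE_I2 allI)
    fix v k l
    show "\<bar>weighted_iterate \<gamma> \<phi> 0 v $ k $ l - weighted_iterate \<gamma>' \<phi> 0 v $ k $ l\<bar>
      \<le> (real (Suc 0) * (\<delta> v / G)) * weighted_iterate (\<lambda>_. G) \<phi> 0 v $ k $ l"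
    proof (cases "v < 0")
      case False
      have "\<bar>\<gamma> v * \<phi> v $ k $ l - \<gamma>' v * \<phi> v $ k $ l\<bar> = \<bar>\<gamma> v - \<gamma>' v\<bar> * \<phi> v $ k $ l"
        using nonneg_kernel_entry(2)[OF \<phi>] by (simp add: abs_mult flip: left_diff_distrib)
      also have "\<dots> \<le> \<delta> v * \<phi> v $ k $ l"
        using diff[of v] False nonneg_kernel_entry(2)[OF \<phi>] by (intro mult_right_mono) auto
      finally show ?thesis using \<open>G > 0\<close> by simp
    qed (use nonneg_kernel_entry(3)[OF \<phi>] in simp)
  qed
next
  case (Suc i)
  have G: "bounded_weight G (\<lambda>_. G)"
    using \<open>G > 0\<close> by (auto simp: bounded_weight_def)
  let ?W = "weighted_iterate \<gamma> \<phi> i" and ?W' = "weighted_iterate \<gamma>' \<phi> i" and ?B = "weighted_iterate (\<lambda>_. G) \<phi> i"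
  note nk = nonneg_kernel_weighted_iterate[OF \<phi> \<gamma>(1), of i] nonneg_kernel_weighted_iterate[OF \<phi> \<gamma>(2), of i]
    nonneg_kernel_weighted_iterate[OF \<phi> G, of i]
  \<comment> \<open>Monotonicity of \<open>\<delta>\<close> replaces \<open>\<delta> s\<close> by
    its value at the outer time \<open>t\<close>, a constant that can be taken out of the
    convolution.\<close>
  have le: "AE s in lebesgue. s \<le> t \<longrightarrow> (\<forall>j. \<bar>?W s $ j $ l - ?W' s $ j $ l\<bar> \<le> (real (Suc i) * (\<delta> t / G)) * ?B s $ j $ l)" for t l
    using Suc
  proof eventually_elim
    case (elim s)
    show ?case
    proof (intro impI allI)
      fix j assume "s \<le> t"
      show "\<bar>?W s $ j $ l - ?W' s $ j $ l\<bar> \<le> (real (Suc i) * (\<delta> t / G)) * ?B s $ j $ l"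
      proof (cases "s < 0")
        case True
        then show ?thesis
          using nonneg_kernel_entry(3)[OF nk(1)] nonneg_kernel_entry(3)[OF nk(2)] nonneg_kernel_entry(3)[OF nk(3)] by simp
      next
        case False
        have "(real (Suc i) * (\<delta> s / G)) * ?B s $ j $ l \<le> (real (Suc i) * (\<delta> t / G)) * ?B s $ j $ l"
          using mono[of s t] False \<open>s \<le> t\<close> \<open>G > 0\<close> nonneg_kernel_entry(2)[OF nk(3)]
          by (intro mult_right_mono mult_left_mono divide_right_mono) auto
        with elim show ?thesis by (meson order_trans)
      qed
    qed
  qed
  have le': "AE s in lebesgue. s \<le> t \<longrightarrow> (\<forall>j. \<bar>?W' s $ j $ l - 0 $ j $ l\<bar> \<le> 1 * ?B s $ j $ l)" for t l
    using weighted_iterate_le[OF \<phi> \<gamma>(2), of i] by eventually_elim (use nonneg_kernel_entry(2)[OF nk(2)] in auto)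
  show ?case
    using AE_conv_defined_weighted_iterate[OF \<phi> \<gamma>(1), of i] AE_conv_defined_weighted_iterate[OF \<phi> \<gamma>(2), of i]
      AE_conv_defined_weighted_iterate[OF \<phi> G, of i] AE_conv_defined[OF \<phi> nonneg_kernel_zero]
  proof eventually_elim
    case (elim v)
    show ?case
    proof (intro allI)
      fix k l
      let ?c = "\<lambda>h. conv \<phi> h v $ k $ l"
      have c: "0 \<le> ?c ?W" "0 \<le> ?c ?W'" "0 \<le> ?c ?B"
        by (intro conv_nonneg \<phi> nk)+
      have 1: "\<bar>?c ?W - ?c ?W'\<bar> \<le> (real (Suc i) * (\<delta> v / G)) * ?c ?B"
        by (rule conv_diff_bound[OF \<phi> nk elim(1) elim(2) elim(3) le])
      have 2: "\<bar>?c ?W'\<bar> \<le> ?c ?B"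
        using conv_diff_bound[OF \<phi> nk(2) nonneg_kernel_zero nk(3) elim(2) elim(4) elim(3) le', of k l]
        by (simp add: conv_zero)
      show "\<bar>weighted_iterate \<gamma> \<phi> (Suc i) v $ k $ l - weighted_iterate \<gamma>' \<phi> (Suc i) v $ k $ l\<bar>
        \<le> (real (Suc (Suc i)) * (\<delta> v / G)) * weighted_iterate (\<lambda>_. G) \<phi> (Suc i) v $ k $ l"
      proof (cases "v < 0")
        case True
        then have "?c h = 0" for h by (simp add: conv_def set_lebesgue_integral_def)
        then show ?thesis by simp
      next
        case False
        have "\<bar>\<gamma> v * ?c ?W - \<gamma>' v * ?c ?W'\<bar> = \<bar>\<gamma> v * (?c ?W - ?c ?W') + (\<gamma> v - \<gamma>' v) * ?c ?W'\<bar>"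
          by (simp add: algebra_simps)
        also have "\<dots> \<le> \<bar>\<gamma> v\<bar> * \<bar>?c ?W - ?c ?W'\<bar> + \<bar>\<gamma> v - \<gamma>' v\<bar> * \<bar>?c ?W'\<bar>"
          by (rule order_trans[OF abs_triangle_ineq]) (simp add: abs_mult)
        also have "\<dots> \<le> G * ((real (Suc i) * (\<delta> v / G)) * ?c ?B) + \<delta> v * ?c ?B"
        proof -
          have "\<bar>\<gamma> v\<bar> \<le> G" "\<bar>\<gamma> v - \<gamma>' v\<bar> \<le> \<delta> v"
            using \<gamma>(1) diff[of v] False by (auto simp: bounded_weight_def)
          moreover from this have "0 \<le> \<delta> v"
            by linarith
          ultimately show ?thesis
            using 1 2 \<open>G > 0\<close> by (intro add_mono mult_mono) simp_all
        qed
        also have "\<dots> = (real (Suc (Suc i)) * (\<delta> v / G)) * (G * ?c ?B)"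
          using \<open>G > 0\<close> by (simp add: field_simps)
        finally show ?thesis by simp
      qed
    qed
  qed
qed

section \<open>An integrable majorant\<close>

lemma norm_matrix_le_sum: "norm (M :: real ^ 'n ^ 'm) \<le> (\<Sum>k\<in>UNIV. \<Sum>l\<in>UNIV. \<bar>M $ k $ l\<bar>)"
proof -
  have "norm M \<le> (\<Sum>k\<in>UNIV. norm (M $ k))"
    by (simp add: norm_vec_def L2_set_le_sum)
  also have "\<dots> \<le> (\<Sum>k\<in>UNIV. \<Sum>l\<in>UNIV. \<bar>M $ k $ l\<bar>)"
    by (intro sum_mono norm_le_l1_cart)
  finally show ?thesis .
qed

text \<open>The integral of the sum equals the sum of the integrals by monotone convergence; it is
  finite, so the sum is finite almost everywhere.\<close>

lemma AE_summable:
  fixes f :: "nat \<Rightarrow> 'a \<Rightarrow> real"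
  assumes int: "\<And>i. integrable M (f i)" and nonneg: "\<And>i x. 0 \<le> f i x"
    and summable: "summable (\<lambda>i. \<integral>x. f i x \<partial>M)"
  shows "AE x in M. summable (\<lambda>i. f i x)"
proof -
  have "(\<integral>\<^sup>+x. (\<Sum>i. ennreal (f i x)) \<partial>M) = (\<Sum>i. \<integral>\<^sup>+x. ennreal (f i x) \<partial>M)"
    using int by (intro nn_integral_suminf) auto
  also have "\<dots> = (\<Sum>i. ennreal (\<integral>x. f i x \<partial>M))"
    using int nonneg by (simp add: nn_integral_eq_integral)
  also have "\<dots> = ennreal (\<Sum>i. \<integral>x. f i x \<partial>M)"
    using nonneg summable by (intro suminf_ennreal2) (auto intro: Bochner_Integration.integral_nonneg)
  finally have "AE x in M. (\<Sum>i. ennreal (f i x)) \<noteq> \<infinity>"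
    using int by (intro nn_integral_noteq_infinite) auto
  then show ?thesis
    by eventually_elim (use nonneg in \<open>auto intro: summable_suminf_not_top\<close>)
qed

lemma integrable_suminf_nonneg:
  fixes f :: "nat \<Rightarrow> 'a \<Rightarrow> real"
  assumes "\<And>i. integrable M (f i)" "\<And>i x. 0 \<le> f i x" "summable (\<lambda>i. \<integral>x. f i x \<partial>M)"
  shows "integrable M (\<lambda>x. \<Sum>i. f i x)"
  using assms AE_summable[OF assms] by (intro integrable_suminf) auto

lemma summable_Suc_mult_power:
  assumes "0 < \<rho>" "\<rho> < (1::real)"
  shows "summable (\<lambda>i. real (Suc i) * \<rho> ^ i)"
  using geometric_deriv_sums[of \<rho>] assms by (auto dest: sums_summable)

text \<open>The term is the square of \<open>real (Suc i) * sqrt \<rho> ^ i\<close>. One factor is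
  bounded, since it tends to 0, and the other is summable.\<close>

lemma summable_Suc_power2_mult_power:
  assumes "0 < \<rho>" "\<rho> < (1::real)"
  shows "summable (\<lambda>i. real (Suc i) * (real (Suc i) * \<rho> ^ i))"
proof -
  let ?f = "\<lambda>i. real (Suc i) * sqrt \<rho> ^ i"
  have s: "summable ?f"
    using assms by (intro summable_Suc_mult_power) auto
  then obtain K where K: "norm (?f i) \<le> K" for i
    using summable_LIMSEQ_zero[THEN convergentI, THEN convergent_imp_Bseq, unfolded Bseq_def] by blast
  have "real (Suc i) * (real (Suc i) * \<rho> ^ i) \<le> K * ?f i" for i
  proof -
    have "real (Suc i) * (real (Suc i) * \<rho> ^ i) = ?f i * ?f i"
      using assms by (simp add: power_mult_distrib[symmetric])
    also have "\<dots> \<le> K * ?f i"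
      using K[of i] assms by (intro mult_right_mono) auto
    finally show ?thesis .
  qed
  then show ?thesis
    using assms by (intro summable_comparison_test'[OF summable_mult[OF s, of K], of 0]) (simp add: power_abs)
qed

section \<open>Subcritical kernels and the summed majorant\<close>

text \<open>The matrix \<open>G\<close> times the masses of \<open>\<phi>\<close> contracts by
  \<open>\<rho>\<close> in the supremum norm weighted by \<open>w\<close>. The normalisation
  \<open>1 \<le> w k\<close> makes sums weighted by \<open>w\<close> dominate plain sums of
  nonnegative entries.\<close>

locale subcritical_kernel =
  fixes \<phi> :: "real \<Rightarrow> real ^ 'p ^ 'p" and G \<rho> :: real and w :: "'p \<Rightarrow> real"
  assumes \<phi>: "nonneg_kernel \<phi>" and G: "0 < G" and \<rho>: "0 < \<rho>" "\<rho> < 1" and w: "\<And>k. 1 \<le> w k"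
    and supersolution: "\<And>k. (\<Sum>l\<in>UNIV. G * (\<integral>t. \<phi> t $ k $ l \<partial>lebesgue) * w l) \<le> \<rho> * w k"
begin

abbreviation iterate where "iterate \<equiv> weighted_iterate (\<lambda>_. G) \<phi>"

text \<open>A scalar that dominates the norm of the matrix, as \<open>w \<ge> 1\<close>, and whose
  integral decays geometrically by the supersolution property.\<close>

definition mass :: "nat \<Rightarrow> real \<Rightarrow> real" where
  "mass i v = (\<Sum>k\<in>UNIV. \<Sum>l\<in>UNIV. iterate i v $ k $ l * w l)"

text \<open>The factor \<open>Suc i\<close> is the one produced by comparing two weights at index
  \<open>i\<close>; being at least 1, it leaves the series large enough to bound the resolvents
  themselves. The series converges only almost everywhere, so even the sign of
  \<open>majorant\<close> is available only almost everywhere.\<close>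

definition majorant :: "real \<Rightarrow> real" where
  "majorant v = (\<Sum>i. real (Suc i) * mass i v)"

text \<open>The common form of both objects: the resolvent in elapsed time for a varying weight, and
  \<open>Psi\<close> for a constant one.\<close>

definition Res :: "(real \<Rightarrow> real) \<Rightarrow> real \<Rightarrow> real ^ 'p ^ 'p" where
  "Res \<gamma> v = (\<Sum>i. weighted_iterate \<gamma> \<phi> i v)"

lemma w_nonneg: "0 \<le> w k"
  using w[of k] by linarith

lemma bounded_weight_G: "bounded_weight G (\<lambda>_. G)"
  using G by (simp add: bounded_weight_def)

lemma iterate: "nonneg_kernel (iterate i)"
  by (rule nonneg_kernel_weighted_iterate[OF \<phi> bounded_weight_G])

lemmas iterate_entry = nonneg_kernel_entry[OF iterate]

lemma mass_nonneg: "0 \<le> mass i v"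
  unfolding mass_def using iterate_entry(2) w_nonneg by (intro sum_nonneg mult_nonneg_nonneg)

lemma mass_neg: "v < 0 \<Longrightarrow> mass i v = 0"
  using iterate_entry(3) by (simp add: mass_def)

lemma integrable_mass: "integrable lebesgue (mass i)"
  unfolding mass_def using iterate_entry(1)
  by (intro Bochner_Integration.integrable_sum integrable_mult_left) simp

text \<open>Masses multiply under convolution, so each step applies the nonnegative matrix of the
  supersolution property once more and gains a factor \<open>\<rho>\<close>.\<close>

lemma row_mass_le: "(\<Sum>l\<in>UNIV. (\<integral>v. iterate i v $ k $ l \<partial>lebesgue) * w l) \<le> \<rho> ^ Suc i * w k"
proof (induction i arbitrary: k)
  case 0
  then show ?case using supersolution[of k] by simp
next
  case (Suc i)
  let ?A = "\<lambda>k l. \<integral>t. \<phi> t $ k $ l \<partial>lebesgue"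
  have A: "0 \<le> ?A k l" for k l
    using nonneg_kernel_entry(2)[OF \<phi>] by simp
  have "(\<Sum>l\<in>UNIV. (\<integral>v. iterate (Suc i) v $ k $ l \<partial>lebesgue) * w l) =
      (\<Sum>l\<in>UNIV. \<Sum>j\<in>UNIV. G * ?A k j * ((\<integral>v. iterate i v $ j $ l \<partial>lebesgue) * w l))"
    using G by (simp add: integral_conv[OF \<phi> iterate] sum_distrib_left sum_distrib_right mult.assoc)
  also have "\<dots> = (\<Sum>j\<in>UNIV. G * ?A k j * (\<Sum>l\<in>UNIV. (\<integral>v. iterate i v $ j $ l \<partial>lebesgue) * w l))"
    by (subst sum.swap) (simp add: sum_distrib_left)
  also have "\<dots> \<le> (\<Sum>j\<in>UNIV. G * ?A k j * (\<rho> ^ Suc i * w j))"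
    using Suc A G by (intro sum_mono mult_left_mono) auto
  also have "\<dots> = \<rho> ^ Suc i * (\<Sum>j\<in>UNIV. G * ?A k j * w j)"
    by (simp add: sum_distrib_left mult_ac)
  also have "\<dots> \<le> \<rho> ^ Suc i * (\<rho> * w k)"
    using \<rho> supersolution by (intro mult_left_mono) auto
  finally show ?case by (simp add: mult_ac)
qed

lemma integral_mass_le: "(\<integral>v. mass i v \<partial>lebesgue) \<le> \<rho> ^ Suc i * (\<Sum>k\<in>UNIV. w k)"
proof -
  have "(\<integral>v. mass i v \<partial>lebesgue) = (\<Sum>k\<in>UNIV. \<Sum>l\<in>UNIV. (\<integral>v. iterate i v $ k $ l \<partial>lebesgue) * w l)"
    unfolding mass_def using iterate_entry(1)
    by simp
  also have "\<dots> \<le> (\<Sum>k\<in>UNIV. \<rho> ^ Suc i * w k)"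
    by (intro sum_mono row_mass_le)
  finally show ?thesis by (simp add: sum_distrib_left)
qed

lemma summable_integral_mass: "summable (\<lambda>i. \<integral>v. real (Suc i) * mass i v \<partial>lebesgue)"
proof (rule summable_comparison_test')
  let ?W = "\<Sum>k\<in>UNIV. w k"
  show "summable (\<lambda>i. real (Suc i) * \<rho> ^ i * (\<rho> * ?W))"
    using \<rho> by (intro summable_mult2 summable_Suc_mult_power)
  fix i
  have "(\<integral>v. real (Suc i) * mass i v \<partial>lebesgue) = real (Suc i) * (\<integral>v. mass i v \<partial>lebesgue)"
    by simp
  also have "\<dots> \<le> real (Suc i) * (\<rho> ^ Suc i * ?W)"
    by (intro mult_left_mono integral_mass_le) simp
  moreover have "0 \<le> (\<integral>v. real (Suc i) * mass i v \<partial>lebesgue)"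
    using mass_nonneg by (intro Bochner_Integration.integral_nonneg mult_nonneg_nonneg) auto
  ultimately show "norm (\<integral>v. real (Suc i) * mass i v \<partial>lebesgue) \<le> real (Suc i) * \<rho> ^ i * (\<rho> * ?W)"
    by (simp add: mult_ac)
qed

lemma AE_summable_mass: "AE v in lebesgue. summable (\<lambda>i. real (Suc i) * mass i v)"
  using integrable_mass mass_nonneg summable_integral_mass by (intro AE_summable) simp_all

lemma integrable_majorant: "integrable lebesgue majorant"
  unfolding majorant_def using integrable_mass mass_nonneg summable_integral_mass
  by (intro integrable_suminf_nonneg) simp_all

lemma majorant_neg: "v < 0 \<Longrightarrow> majorant v = 0"
  by (simp add: majorant_def mass_neg)

lemma iterate_has_sqrt_moments:
  assumes "has_sqrt_moments \<phi>"
  shows "has_sqrt_moments (iterate i)"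
proof (induction i)
  case 0
  then show ?case using assms by (simp add: has_sqrt_moments_def mult.left_commute)
next
  case (Suc i)
  from sqrt_moment_conv(1)[OF \<phi> assms iterate Suc]
  show ?case by (simp add: has_sqrt_moments_def mult.left_commute)
qed

text \<open>By the product rule the moment falls on one of the \<open>Suc i\<close> factors,
  contributing \<open>\<beta>\<close>, while each of the \<open>i\<close> others contributes its
  mass and hence a factor \<open>\<rho>\<close>.\<close>

lemma row_sqrt_moment_le:
  assumes m: "has_sqrt_moments \<phi>"
  defines "\<beta> \<equiv> (\<Sum>k\<in>UNIV. \<Sum>l\<in>UNIV. G * sqrt_moment \<phi> k l * w l)"
  shows "(\<Sum>l\<in>UNIV. sqrt_moment (iterate i) k l * w l) \<le> real (Suc i) * \<beta> * \<rho> ^ i * w k"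
proof (induction i arbitrary: k)
  have s: "0 \<le> sqrt_moment \<phi> k l" for k l
    using sqrt_mult_entry_nonneg[OF \<phi>] by (simp add: sqrt_moment_def)
  then have "0 \<le> G * sqrt_moment \<phi> k l * w l" for k l
    using G w_nonneg by simp
  \<comment> \<open>\<open>\<beta>\<close> is the total over all rows and thus bounds each row;
    \<open>w k \<ge> 1\<close> then turns \<open>\<beta>\<close> into
    \<open>\<beta> * w k\<close>.\<close>
  then have "(\<Sum>l\<in>UNIV. G * sqrt_moment \<phi> k l * w l) \<le> \<beta>" and \<beta>: "0 \<le> \<beta>" for k
    unfolding \<beta>_def by (auto intro!: member_le_sum[where f = "\<lambda>k. \<Sum>l\<in>UNIV. G * sqrt_moment \<phi> k l * w l"] sum_nonneg)
  then have row: "(\<Sum>l\<in>UNIV. G * sqrt_moment \<phi> k l * w l) \<le> \<beta> * w k" for k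
    using mult_left_mono[OF w[of k] \<beta>] by (metis mult.right_neutral order_trans)
  have scale: "sqrt_moment (\<lambda>v. G *\<^sub>R f v) k l = G * sqrt_moment f k l" for f :: "real \<Rightarrow> real ^ 'p ^ 'p" and k l
    unfolding sqrt_moment_def by (simp add: mult.left_commute)
  {
    case 0
    then show ?case using row[of k] by (simp add: scale)
  next
    case (Suc i)
    let ?A = "\<lambda>k l. \<integral>t. \<phi> t $ k $ l \<partial>lebesgue" and ?I = "\<lambda>k l. \<integral>t. iterate i t $ k $ l \<partial>lebesgue"
    have A: "0 \<le> ?A k l" for k l
      using nonneg_kernel_entry(2)[OF \<phi>] by simp
    have "(\<Sum>l\<in>UNIV. sqrt_moment (iterate (Suc i)) k l * w l) =
        (\<Sum>l\<in>UNIV. G * sqrt_moment (conv \<phi> (iterate i)) k l * w l)"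
      by (simp add: scale)
    also have "\<dots> \<le> (\<Sum>l\<in>UNIV. G * (\<Sum>j\<in>UNIV. sqrt_moment \<phi> k j * ?I j l + ?A k j * sqrt_moment (iterate i) j l) * w l)"
      using G w_nonneg sqrt_moment_conv(2)[OF \<phi> m iterate iterate_has_sqrt_moments[OF m]]
      by (intro sum_mono mult_right_mono mult_left_mono) auto
    also have "\<dots> = (\<Sum>l\<in>UNIV. \<Sum>j\<in>UNIV. G * sqrt_moment \<phi> k j * (?I j l * w l) + G * ?A k j * (sqrt_moment (iterate i) j l * w l))"
      by (simp only: sum_distrib_left sum_distrib_right distrib_left distrib_right mult.assoc)
    also have "\<dots> = (\<Sum>j\<in>UNIV. G * sqrt_moment \<phi> k j * (\<Sum>l\<in>UNIV. ?I j l * w l) +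
        G * ?A k j * (\<Sum>l\<in>UNIV. sqrt_moment (iterate i) j l * w l))"
      by (subst sum.swap) (simp add: sum_distrib_left sum.distrib)
    also have "\<dots> \<le> (\<Sum>j\<in>UNIV. G * sqrt_moment \<phi> k j * (\<rho> ^ Suc i * w j) +
        G * ?A k j * (real (Suc i) * \<beta> * \<rho> ^ i * w j))"
      using Suc A s G by (intro sum_mono add_mono mult_left_mono row_mass_le) auto
    also have "\<dots> = \<rho> ^ Suc i * (\<Sum>j\<in>UNIV. G * sqrt_moment \<phi> k j * w j) +
        real (Suc i) * \<beta> * \<rho> ^ i * (\<Sum>j\<in>UNIV. G * ?A k j * w j)"
      by (simp add: sum_distrib_left sum.distrib mult_ac)
    also have "\<dots> \<le> \<rho> ^ Suc i * (\<beta> * w k) + real (Suc i) * \<beta> * \<rho> ^ i * (\<rho> * w k)"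
      using \<rho> \<beta> row supersolution by (intro add_mono mult_left_mono) auto
    also have "\<dots> = real (Suc (Suc i)) * \<beta> * \<rho> ^ Suc i * w k"
      by (simp add: algebra_simps)
    finally show ?case .
  }
qed

text \<open>The factor \<open>Suc i\<close> of the majorant meets the factor \<open>Suc i\<close> of
  the moment bound, so the integrals are dominated by the series of
  \<open>(i + 1)^2 \<rho>^i\<close>.\<close>

lemma integrable_sqrt_majorant:
  assumes m: "has_sqrt_moments \<phi>"
  shows "integrable lebesgue (\<lambda>v. sqrt v * majorant v)"
proof -
  define \<beta> where "\<beta> = (\<Sum>k\<in>UNIV. \<Sum>l\<in>UNIV. G * sqrt_moment \<phi> k l * w l)"
  note im = iterate_has_sqrt_moments[OF m, unfolded has_sqrt_moments_def, rule_format]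
  define f where "f i v = real (Suc i) * (sqrt v * mass i v)" for i v
  have f_sum: "f i v = (\<Sum>k\<in>UNIV. \<Sum>l\<in>UNIV. real (Suc i) * (sqrt v * iterate i v $ k $ l) * w l)" for i v
    unfolding f_def mass_def sum_distrib_left by (simp add: mult_ac)
  have int: "integrable lebesgue (f i)" for i
    unfolding f_sum using im
    by (intro Bochner_Integration.integrable_sum integrable_mult_left integrable_mult_right) simp
  have nonneg: "0 \<le> f i v" for i v
    by (cases "v < 0") (auto simp: f_def mass_neg mass_nonneg)
  have "(\<integral>v. f i v \<partial>lebesgue) \<le> real (Suc i) * (real (Suc i) * \<rho> ^ i) * (\<beta> * (\<Sum>k\<in>UNIV. w k))" for i
  proof -
    have "(\<integral>v. f i v \<partial>lebesgue) = (\<Sum>k\<in>UNIV. \<Sum>l\<in>UNIV. real (Suc i) * sqrt_moment (iterate i) k l * w l)"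
      unfolding f_sum sqrt_moment_def using im
      by (simp del: of_nat_Suc)
    also have "\<dots> = (\<Sum>k\<in>UNIV. real (Suc i) * (\<Sum>l\<in>UNIV. sqrt_moment (iterate i) k l * w l))"
      by (simp add: sum_distrib_left mult_ac)
    also have "\<dots> \<le> (\<Sum>k\<in>UNIV. real (Suc i) * (real (Suc i) * \<beta> * \<rho> ^ i * w k))"
      unfolding \<beta>_def by (intro sum_mono mult_left_mono row_sqrt_moment_le m) simp
    finally show ?thesis by (simp add: sum_distrib_left mult_ac)
  qed
  then have summable: "summable (\<lambda>i. \<integral>v. f i v \<partial>lebesgue)"
    using \<rho> nonneg
    by (intro summable_comparison_test'[OF summable_mult2[OF summable_Suc_power2_mult_power], of \<rho> 0])
      (auto simp: abs_of_nonneg[OF Bochner_Integration.integral_nonneg] simp del: of_nat_Suc)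
  have "integrable lebesgue (\<lambda>v. \<Sum>i. f i v)"
    by (rule integrable_suminf_nonneg[OF int nonneg summable])
  \<comment> \<open>\<open>sqrt v\<close> is taken out of the series where the latter converges,
    which is almost everywhere.\<close>
  moreover have "AE v in lebesgue. (\<Sum>i. f i v) = sqrt v * majorant v"
    using AE_summable_mass
  proof eventually_elim
    case (elim v)
    then show ?case
      unfolding majorant_def f_def suminf_mult[OF elim, symmetric] by (simp add: mult_ac)
  qed
  ultimately show ?thesis
    by (subst integrable_cong_AE[symmetric]) (use integrable_majorant in \<open>auto simp: measurable_completion intro!: borel_measurable_times\<close>)
qed

lemma weighted_iterate_norm_le:
  assumes "bounded_weight G \<gamma>"
  shows "AE v in lebesgue. \<forall>i. norm (weighted_iterate \<gamma> \<phi> i v) \<le> mass i v"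
  unfolding AE_all_countable
proof
  fix i
  note nn = nonneg_kernel_entry(2)[OF nonneg_kernel_weighted_iterate[OF \<phi> assms]]
  show "AE v in lebesgue. norm (weighted_iterate \<gamma> \<phi> i v) \<le> mass i v"
    using weighted_iterate_le[OF \<phi> assms, of i]
  proof eventually_elim
    case (elim v)
    have "norm (weighted_iterate \<gamma> \<phi> i v) \<le> (\<Sum>k\<in>UNIV. \<Sum>l\<in>UNIV. weighted_iterate \<gamma> \<phi> i v $ k $ l)"
      using norm_matrix_le_sum[of "weighted_iterate \<gamma> \<phi> i v"] nn by simp
    also have "\<dots> \<le> mass i v"
      unfolding mass_def
    proof (intro sum_mono)
      fix k l
      have "weighted_iterate \<gamma> \<phi> i v $ k $ l \<le> iterate i v $ k $ l * 1"
        using elim by simp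
      also have "\<dots> \<le> iterate i v $ k $ l * w l"
        using w iterate_entry(2) by (intro mult_left_mono) auto
      finally show "weighted_iterate \<gamma> \<phi> i v $ k $ l \<le> iterate i v $ k $ l * w l" .
    qed
    finally show ?case .
  qed
qed

lemma summable_mass_imp:
  assumes "summable (\<lambda>i. real (Suc i) * mass i v)"
  shows "summable (\<lambda>i. mass i v)"
proof (rule summable_comparison_test'[OF assms])
  show "norm (mass i v) \<le> real (Suc i) * mass i v" for i
    using mass_nonneg[of i v] by (simp add: algebra_simps)
qed

lemma AE_summable_weighted_iterate:
  assumes "bounded_weight G \<gamma>"
  shows "AE v in lebesgue. summable (\<lambda>i. weighted_iterate \<gamma> \<phi> i v)"
  using weighted_iterate_norm_le[OF assms] AE_summable_mass
proof eventually_elim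
  case (elim v)
  show ?case
    by (rule summable_comparison_test'[OF summable_mass_imp[OF elim(2)], of 0]) (use elim(1) in simp)
qed

lemma norm_Res_le:
  assumes "bounded_weight G \<gamma>"
  shows "AE v in lebesgue. norm (Res \<gamma> v) \<le> majorant v"
  using weighted_iterate_norm_le[OF assms] AE_summable_mass
proof eventually_elim
  case (elim v)
  have s: "summable (\<lambda>i. norm (weighted_iterate \<gamma> \<phi> i v))"
    by (rule summable_comparison_test'[OF summable_mass_imp[OF elim(2)], of 0]) (use elim(1) in simp)
  have "norm (Res \<gamma> v) \<le> (\<Sum>i. norm (weighted_iterate \<gamma> \<phi> i v))"
    unfolding Res_def by (rule summable_norm[OF s])
  also have "\<dots> \<le> majorant v"
    unfolding majorant_def
  proof (rule suminf_le[OF _ s elim(2)])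
    fix i
    have "norm (weighted_iterate \<gamma> \<phi> i v) \<le> mass i v"
      using elim(1) by simp
    also have "\<dots> \<le> real (Suc i) * mass i v"
      using mass_nonneg[of i v] by (simp add: algebra_simps)
    finally show "norm (weighted_iterate \<gamma> \<phi> i v) \<le> real (Suc i) * mass i v" .
  qed
  finally show ?case .
qed

lemma norm_Res_diff_le:
  assumes \<gamma>: "bounded_weight G \<gamma>" "bounded_weight G \<gamma>'"
    and diff: "\<And>v. 0 \<le> v \<Longrightarrow> \<bar>\<gamma> v - \<gamma>' v\<bar> \<le> \<delta> v"
    and mono: "\<And>v v'. 0 \<le> v \<Longrightarrow> v \<le> v' \<Longrightarrow> \<delta> v \<le> \<delta> v'"
  shows "AE v in lebesgue. norm (Res \<gamma> v - Res \<gamma>' v) \<le> \<delta> v / G * majorant v"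
proof -
  have "AE v in lebesgue. \<forall>i. \<forall>k l. \<bar>weighted_iterate \<gamma> \<phi> i v $ k $ l - weighted_iterate \<gamma>' \<phi> i v $ k $ l\<bar>
    \<le> (real (Suc i) * (\<delta> v / G)) * iterate i v $ k $ l"
    by (subst AE_all_countable, rule allI)
      (rule weighted_iterate_diff[where \<delta> = \<delta>, OF \<phi> \<gamma> G diff mono])
  then show ?thesis
    using AE_summable_weighted_iterate[OF \<gamma>(1)] AE_summable_weighted_iterate[OF \<gamma>(2)] AE_summable_mass
  proof eventually_elim
    case (elim v)
    show ?case
    proof (cases "v < 0")
      \<comment> \<open>Nothing is known about \<open>\<delta>\<close> at negative \<open>v\<close>,
        but both sides vanish there.\<close>
      case True
      then have "weighted_iterate \<gamma> \<phi> i v = 0" "weighted_iterate \<gamma>' \<phi> i v = 0" for i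
        using nonneg_kernel_entry(3)[OF nonneg_kernel_weighted_iterate[OF \<phi>]] \<gamma> by blast+
      then show ?thesis using True by (simp add: Res_def majorant_neg)
    next
      case False
      then have \<delta>: "0 \<le> \<delta> v / G"
        using diff[of v] G by auto
      let ?d = "\<lambda>i. weighted_iterate \<gamma> \<phi> i v - weighted_iterate \<gamma>' \<phi> i v"
      have le: "norm (?d i) \<le> \<delta> v / G * (real (Suc i) * mass i v)" for i
      proof -
        have "norm (?d i) \<le> (\<Sum>k\<in>UNIV. \<Sum>l\<in>UNIV. \<bar>?d i $ k $ l\<bar>)"
          by (rule norm_matrix_le_sum)
        also have "\<dots> \<le> (\<Sum>k\<in>UNIV. \<Sum>l\<in>UNIV. (real (Suc i) * (\<delta> v / G)) * (iterate i v $ k $ l * w l))"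
        proof (intro sum_mono)
          fix k l
          have "\<bar>?d i $ k $ l\<bar> \<le> (real (Suc i) * (\<delta> v / G)) * (iterate i v $ k $ l * 1)"
            using elim(1) by simp
          also have "\<dots> \<le> (real (Suc i) * (\<delta> v / G)) * (iterate i v $ k $ l * w l)"
            using w iterate_entry(2) \<delta> by (intro mult_left_mono mult_nonneg_nonneg) auto
          finally show "\<bar>?d i $ k $ l\<bar> \<le> (real (Suc i) * (\<delta> v / G)) * (iterate i v $ k $ l * w l)" .
        qed
        also have "\<dots> = \<delta> v / G * (real (Suc i) * mass i v)"
          unfolding mass_def sum_distrib_left by (simp add: mult_ac)
        finally show ?thesis .
      qed
      have s': "summable (\<lambda>i. \<delta> v / G * (real (Suc i) * mass i v))"
        by (rule summable_mult[OF elim(4)])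
      have s: "summable (\<lambda>i. norm (?d i))"
        by (rule summable_comparison_test'[OF s', of 0]) (use le in simp)
      have "norm (Res \<gamma> v - Res \<gamma>' v) = norm (\<Sum>i. ?d i)"
        unfolding Res_def using elim by (simp add: suminf_diff)
      also have "\<dots> \<le> (\<Sum>i. norm (?d i))"
        by (rule summable_norm[OF s])
      also have "\<dots> \<le> (\<Sum>i. \<delta> v / G * (real (Suc i) * mass i v))"
        by (rule suminf_le[OF le s s'])
      also have "\<dots> = \<delta> v / G * majorant v"
        unfolding majorant_def by (rule suminf_mult[OF elim(4)])
      finally show ?thesis .
    qed
  qed
qed

lemma integrable_Res:
  assumes "bounded_weight G \<gamma>"
  shows "integrable lebesgue (Res \<gamma>)"
proof (rule Bochner_Integration.integrable_bound[OF integrable_majorant])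
  have "weighted_iterate \<gamma> \<phi> i \<in> borel_measurable lebesgue" for i
    using nonneg_kernel_weighted_iterate[OF \<phi> assms, of i] by (auto simp: nonneg_kernel_def)
  then show "Res \<gamma> \<in> borel_measurable lebesgue"
    unfolding Res_def by (intro borel_measurable_suminf)
  show "AE v in lebesgue. norm (Res \<gamma> v) \<le> norm (majorant v)"
    using norm_Res_le[OF assms] by eventually_elim simp
qed

end

section \<open>The deviation\<close>

lemma bounded_bilinear_matrix_vector_mult:
  "bounded_bilinear ((*v) :: real ^ 'n ^ 'm \<Rightarrow> real ^ 'n \<Rightarrow> real ^ 'm)"
  unfolding bilinear_conv_bounded_bilinear[symmetric] bilinear_def
  by (intro conjI allI linearI)
    (simp_all add: matrix_vector_mult_add_rdistrib matrix_vector_right_distrib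
      scaleR_matrix_vector_assoc matrix_vector_mult_scaleR)

text \<open>This controls the loss from stopping at \<open>T u\<close>: in elapsed time, the inner
  integral started at \<open>s = T x\<close> ends at \<open>T (u - x)\<close>. After Tonelli, for
  fixed \<open>v \<ge> 0\<close>, the points \<open>x\<close> of \<open>[0, u]\<close> with
  \<open>T (u - x) < v\<close> lie in an interval of length at most
  \<open>min (v / T) 1\<close>.\<close>

lemma
  fixes S :: "real \<Rightarrow> ennreal"
  assumes S: "S \<in> borel_measurable lebesgue" and T: "T > 0" and u: "u \<le> 1"
  shows borel_measurable_nn_tail:
      "(\<lambda>x. \<integral>\<^sup>+v. (if T * (u - x) < v then S v else 0) \<partial>lebesgue) \<in> borel_measurable borel" (is ?th1)
    and nn_integral_tail_le:
      "(\<integral>\<^sup>+x. indicator {0..u} x * (\<integral>\<^sup>+v. (if T * (u - x) < v then S v else 0) \<partial>lebesgue) \<partial>lebesgue) \<le>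
       (\<integral>\<^sup>+v. ennreal (min (v / T) 1) * S v \<partial>lebesgue)" (is ?th2)
proof -
  obtain S' where [measurable]: "S' \<in> borel_measurable borel" and SS': "AE x in lborel. S x = S' x"
    using completion_ex_borel_measurable[OF S] by auto
  have eq: "(\<integral>\<^sup>+v. (if T * (u - x) < v then S v else 0) \<partial>lebesgue) =
      (\<integral>\<^sup>+v. (if T * (u - x) < v then S' v else 0) \<partial>lborel)" for x
    unfolding nn_integral_completion
  proof (rule nn_integral_cong_AE)
    show "AE v in lborel. (if T * (u - x) < v then S v else 0) = (if T * (u - x) < v then S' v else 0)"
      using SS' by eventually_elim simp
  qed
  show ?th1
    unfolding eq by measurable
  have "(\<integral>\<^sup>+x. indicator {0..u} x * (\<integral>\<^sup>+v. (if T * (u - x) < v then S v else 0) \<partial>lebesgue) \<partial>lebesgue) =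
      (\<integral>\<^sup>+x. (\<integral>\<^sup>+v. indicator {0..u} x * (if T * (u - x) < v then S' v else 0) \<partial>lborel) \<partial>lborel)"
    unfolding eq unfolding nn_integral_completion
    by (intro nn_integral_cong nn_integral_cmult[symmetric]) measurable
  also have "\<dots> = (\<integral>\<^sup>+v. (\<integral>\<^sup>+x. indicator {0..u} x * (if T * (u - x) < v then S' v else 0) \<partial>lborel) \<partial>lborel)"
    by (rule lborel_pair.Fubini'[symmetric]) measurable
  also have "\<dots> \<le> (\<integral>\<^sup>+v. ennreal (min (v / T) 1) * S' v \<partial>lborel)"
  proof (rule nn_integral_mono)
    fix v
    have "(\<integral>\<^sup>+x. indicator {0..u} x * (if T * (u - x) < v then S' v else 0) \<partial>lborel) \<le>
        (\<integral>\<^sup>+x. S' v * indicator {max 0 (u - v / T)..u} x \<partial>lborel)"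
      using T by (intro nn_integral_mono) (auto simp: indicator_def field_simps)
    also have "\<dots> = S' v * emeasure lborel {max 0 (u - v / T)..u}"
      by (rule nn_integral_cmult_indicator) simp
    also have "\<dots> \<le> S' v * ennreal (min (v / T) 1)"
      using u by (intro mult_left_mono) (auto simp: emeasure_lborel_Icc_eq intro!: ennreal_leI)
    finally show "(\<integral>\<^sup>+x. indicator {0..u} x * (if T * (u - x) < v then S' v else 0) \<partial>lborel) \<le>
        ennreal (min (v / T) 1) * S' v"
      by (simp add: mult.commute)
  qed
  also have "\<dots> = (\<integral>\<^sup>+v. ennreal (min (v / T) 1) * S v \<partial>lborel)"
  proof (rule nn_integral_cong_AE)
    show "AE v in lborel. ennreal (min (v / T) 1) * S' v = ennreal (min (v / T) 1) * S v"
      using SS' by eventually_elim simp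
  qed
  finally show ?th2
    by (simp only: nn_integral_completion)
qed

lemma sqrt_mult_divide_self:
  assumes "T > 0"
  shows "sqrt T * (v / T) = v / sqrt T"
proof -
  have "sqrt T * (v / T) = (T / sqrt T) * (v / T)"
    using assms by (simp only: real_div_sqrt less_imp_le)
  also have "\<dots> = v / sqrt T"
    using assms by simp
  finally show ?thesis .
qed

section \<open>Continuity of integrated resolvents and decay of the error rate\<close>

context subcritical_kernel
begin

lemma AE_majorant_nonneg: "AE v in lebesgue. 0 \<le> majorant v"
  using norm_Res_le[OF bounded_weight_G] by eventually_elim (meson norm_ge_zero order_trans)

text \<open>Dominated convergence with \<open>majorant\<close>. It provides integrability of the
  outer integrands in the deviation; the cutoff \<open>c\<close> is an indicator whose endpoint may
  move with \<open>x\<close>, so its continuity in \<open>x\<close> can be expected only for almost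
  every \<open>v\<close>.\<close>

lemma continuous_integral_Res:
  assumes bw: "\<And>x. bounded_weight G (\<Gamma> x)"
    and lip: "\<And>x y v. \<bar>\<Gamma> x v - \<Gamma> y v\<bar> \<le> L * \<bar>x - y\<bar>"
    and c: "\<And>x. c x \<in> borel_measurable lebesgue" "\<And>x v. \<bar>c x v\<bar> \<le> 1"
      "\<And>x. AE v in lebesgue. isCont (\<lambda>x. c x v) x"
  shows "continuous_on UNIV (\<lambda>x. \<integral>v. c x v *\<^sub>R Res (\<Gamma> x) v \<partial>lebesgue)"
proof (intro continuous_at_imp_continuous_on ballI)
  fix x :: real
  show "isCont (\<lambda>x. \<integral>v. c x v *\<^sub>R Res (\<Gamma> x) v \<partial>lebesgue) x"
    unfolding continuous_at_sequentially
  proof (intro allI impI)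
    fix X :: "nat \<Rightarrow> real" assume X: "X \<longlonglongrightarrow> x"
    have meas: "(\<lambda>v. c y v *\<^sub>R Res (\<Gamma> y) v) \<in> borel_measurable lebesgue" for y
      using c(1) integrable_Res[OF bw[of y]] by (intro borel_measurable_scaleR) auto
    \<comment> \<open>Working along a sequence leaves countably many exceptional null sets, which
      unite to one.\<close>
    have "AE v in lebesgue. \<forall>n. norm (Res (\<Gamma> (X n)) v - Res (\<Gamma> x) v) \<le> L * \<bar>X n - x\<bar> / G * majorant v"
    proof (subst AE_all_countable, rule allI)
      show "AE v in lebesgue. norm (Res (\<Gamma> (X n)) v - Res (\<Gamma> x) v) \<le> L * \<bar>X n - x\<bar> / G * majorant v" for n
      proof (rule norm_Res_diff_le[where \<delta> = "\<lambda>_. L * \<bar>X n - x\<bar>", OF bw bw])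
        show "\<bar>\<Gamma> (X n) v - \<Gamma> x v\<bar> \<le> L * \<bar>X n - x\<bar>" for v
          by (rule lip)
      qed simp
    qed
    then have lim: "AE v in lebesgue. (\<lambda>n. c (X n) v *\<^sub>R Res (\<Gamma> (X n)) v) \<longlonglongrightarrow> c x v *\<^sub>R Res (\<Gamma> x) v"
      using c(3)[of x]
    proof eventually_elim
      case (elim v)
      have eq: "L / G * majorant v * \<bar>X n - x\<bar> = L * \<bar>X n - x\<bar> / G * majorant v" for n
        by simp
      have "(\<lambda>n. L / G * majorant v * \<bar>X n - x\<bar>) \<longlonglongrightarrow> 0"
        by (rule tendsto_mult_right_zero[OF tendsto_rabs_zero[OF LIM_zero[OF X]]])
      then have "(\<lambda>n. Res (\<Gamma> (X n)) v - Res (\<Gamma> x) v) \<longlonglongrightarrow> 0"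
        unfolding eq by (rule Lim_null_comparison[OF always_eventually[OF elim(1)]])
      then have "(\<lambda>n. Res (\<Gamma> (X n)) v) \<longlonglongrightarrow> Res (\<Gamma> x) v"
        by (simp add: LIM_zero_iff)
      moreover have "(\<lambda>n. c (X n) v) \<longlonglongrightarrow> c x v"
        by (rule isCont_tendsto_compose[OF elim(2) X])
      ultimately show ?case by (intro tendsto_scaleR)
    qed
    have bound: "AE v in lebesgue. norm (c y v *\<^sub>R Res (\<Gamma> y) v) \<le> majorant v" for y
      using norm_Res_le[OF bw[of y]]
    proof eventually_elim
      case (elim v)
      have "norm (c y v *\<^sub>R Res (\<Gamma> y) v) \<le> 1 * norm (Res (\<Gamma> y) v)"
        unfolding norm_scaleR using c(2) by (intro mult_right_mono) auto
      with elim show ?case by simp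
    qed
    show "((\<lambda>x. \<integral>v. c x v *\<^sub>R Res (\<Gamma> x) v \<partial>lebesgue) \<circ> X) \<longlonglongrightarrow> (\<integral>v. c x v *\<^sub>R Res (\<Gamma> x) v \<partial>lebesgue)"
      unfolding comp_def by (rule integral_dominated_convergence[OF meas meas integrable_majorant lim bound])
  qed
qed

text \<open>One quantity for both errors: the change of the weight during elapsed time
  \<open>v\<close> and the truncation at \<open>T u\<close>.\<close>

definition tail_rate :: "real \<Rightarrow> real" where
  "tail_rate T = (\<integral>v. min (v / T) 1 * majorant v \<partial>lebesgue)"

lemma min_majorant_nonneg:
  assumes "T > 0" "0 \<le> majorant v"
  shows "0 \<le> min (v / T) 1 * majorant v"
  using assms by (cases "v < 0") (auto simp: majorant_neg)

lemma borel_measurable_min_majorant: "(\<lambda>v. min (v / T) 1 * majorant v) \<in> borel_measurable lebesgue"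
proof -
  have "(\<lambda>v. min (v / T) 1) \<in> borel_measurable lebesgue"
    by (intro measurable_completion) simp
  then show ?thesis
    using integrable_majorant by (intro borel_measurable_times) auto
qed

lemma integrable_min_majorant:
  assumes "T > 0"
  shows "integrable lebesgue (\<lambda>v. min (v / T) 1 * majorant v)"
proof (rule Bochner_Integration.integrable_bound[OF integrable_majorant])
  show "(\<lambda>v. min (v / T) 1 * majorant v) \<in> borel_measurable lebesgue"
    by (rule borel_measurable_min_majorant)
  have "norm (min (v / T) 1 * majorant v) \<le> norm (majorant v)" for v
    using assms by (cases "v < 0") (auto simp: majorant_neg abs_mult intro!: mult_left_le_one_le)
  then show "AE v in lebesgue. norm (min (v / T) 1 * majorant v) \<le> norm (majorant v)"
    by simp
qed

lemma nn_integral_min_majorant: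
  assumes "T > 0"
  shows "(\<integral>\<^sup>+v. ennreal (min (v / T) 1 * majorant v) \<partial>lebesgue) = ennreal (tail_rate T)"
  unfolding tail_rate_def
proof (rule nn_integral_eq_integral[OF integrable_min_majorant[OF assms]])
  show "AE v in lebesgue. 0 \<le> min (v / T) 1 * majorant v"
    using AE_majorant_nonneg by eventually_elim (rule min_majorant_nonneg[OF assms])
qed

lemma nn_integral_min_mult_majorant:
  assumes "T > 0"
  shows "(\<integral>\<^sup>+v. ennreal (min (v / T) 1) * ennreal (majorant v) \<partial>lebesgue) = ennreal (tail_rate T)"
  unfolding nn_integral_min_majorant[OF assms, symmetric]
proof (rule nn_integral_cong_AE)
  show "AE v in lebesgue. ennreal (min (v / T) 1) * ennreal (majorant v) = ennreal (min (v / T) 1 * majorant v)"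
    using AE_majorant_nonneg
  proof eventually_elim
    case (elim v)
    then show ?case
      using assms by (cases "v < 0") (auto simp: majorant_neg ennreal_mult)
  qed
qed

lemma tail_rate_nonneg: "T > 0 \<Longrightarrow> 0 \<le> tail_rate T"
  unfolding tail_rate_def using AE_majorant_nonneg
  by (intro integral_nonneg_AE) (auto elim!: eventually_mono intro: min_majorant_nonneg)

lemma tail_rate_tendsto_0: "(tail_rate \<longlongrightarrow> 0) at_top"
proof -
  have "((\<lambda>T. \<integral>v. min (v / T) 1 * majorant v \<partial>lebesgue) \<longlongrightarrow> (\<integral>v. 0 \<partial>(lebesgue :: real measure))) at_top"
  proof (rule integral_dominated_convergence_at_top)
    show "(\<lambda>v. min (v / T) 1 * majorant v) \<in> borel_measurable lebesgue" for T
      by (rule borel_measurable_min_majorant)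
    show "integrable lebesgue (\<lambda>v. norm (majorant v))"
      using integrable_majorant by simp
    have "((\<lambda>T. min (v / T) 1 * majorant v) \<longlongrightarrow> min 0 1 * majorant v) at_top" for v
      by (intro tendsto_intros tendsto_divide_0[OF tendsto_const] filterlim_at_top_imp_at_infinity filterlim_ident)
    then show "AE v in lebesgue. ((\<lambda>T. min (v / T) 1 * majorant v) \<longlongrightarrow> 0) at_top"
      by simp
    show "\<forall>\<^sub>F T in at_top. AE v in lebesgue. norm (min (v / T) 1 * majorant v) \<le> norm (majorant v)"
      using eventually_gt_at_top[of 0]
    proof eventually_elim
      case (elim T)
      have "norm (min (v / T) 1 * majorant v) \<le> norm (majorant v)" for v
        using elim by (cases "v < 0") (auto simp: majorant_neg abs_mult intro!: mult_left_le_one_le)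
      then show ?case by simp
    qed
  qed simp
  then show ?thesis
    by (simp add: tail_rate_def[abs_def])
qed

text \<open>Since \<open>min y 1 \<le> sqrt y\<close> for \<open>y \<ge> 0\<close>, the integrand is
  dominated by \<open>sqrt v\<close> times the majorant, while for \<open>T \<ge> v\<close> it
  equals \<open>v / sqrt T\<close> times the majorant and tends to 0. Dominated convergence thus
  gives a little-o rather than only a bound.\<close>

lemma sqrt_mult_tail_rate_tendsto_0:
  assumes m: "has_sqrt_moments \<phi>"
  shows "((\<lambda>T. sqrt T * tail_rate T) \<longlongrightarrow> 0) at_top"
proof -
  have "((\<lambda>T. \<integral>v. sqrt T * (min (v / T) 1 * majorant v) \<partial>lebesgue) \<longlongrightarrow> (\<integral>v. 0 \<partial>(lebesgue :: real measure))) at_top"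
  proof (rule integral_dominated_convergence_at_top)
    show "(\<lambda>v. sqrt T * (min (v / T) 1 * majorant v)) \<in> borel_measurable lebesgue" for T
      by (intro borel_measurable_times borel_measurable_const borel_measurable_min_majorant)
    show "integrable lebesgue (\<lambda>v. norm (sqrt v * majorant v))"
      using integrable_sqrt_majorant[OF m] by (rule integrable_norm)
    show "AE v in lebesgue. ((\<lambda>T. sqrt T * (min (v / T) 1 * majorant v)) \<longlongrightarrow> 0) at_top"
    proof (intro AE_I2)
      fix v
      show "((\<lambda>T. sqrt T * (min (v / T) 1 * majorant v)) \<longlongrightarrow> 0) at_top"
      proof (cases "v < 0")
        case False
        have "((\<lambda>T. v / sqrt T * majorant v) \<longlongrightarrow> 0 * majorant v) at_top"
          by (intro tendsto_intros tendsto_divide_0[OF tendsto_const] filterlim_at_top_imp_at_infinity sqrt_at_top)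
        moreover have "\<forall>\<^sub>F T in at_top. v / sqrt T * majorant v = sqrt T * (min (v / T) 1 * majorant v)"
          using eventually_ge_at_top[of "max 1 v"]
        proof eventually_elim
          case (elim T)
          then have "min (v / T) 1 = v / T" "sqrt T * (v / T) = v / sqrt T"
            by (simp, intro sqrt_mult_divide_self) simp
          then show ?case by (simp only: mult.assoc[symmetric])
        qed
        ultimately show ?thesis
          by (auto intro: Lim_transform_eventually)
      qed (simp add: majorant_neg)
    qed
    show "\<forall>\<^sub>F T in at_top. AE v in lebesgue. norm (sqrt T * (min (v / T) 1 * majorant v)) \<le> norm (sqrt v * majorant v)"
      using eventually_gt_at_top[of 0]
    proof eventually_elim
      case (elim T)
      have "norm (sqrt T * (min (v / T) 1 * majorant v)) \<le> norm (sqrt v * majorant v)" for v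
      proof (cases "v < 0")
        case False
        have "sqrt T * min (v / T) 1 \<le> sqrt v"
        proof (cases "v \<le> T")
          case True
          have "sqrt T * min (v / T) 1 \<le> sqrt T * (v / T)"
            using elim by (intro mult_left_mono) auto
          also have "\<dots> = sqrt v * (sqrt v / sqrt T)"
            unfolding sqrt_mult_divide_self[OF elim] using False by simp
          also have "\<dots> \<le> sqrt v * 1"
            using elim False True by (intro mult_left_mono) auto
          finally show ?thesis by simp
        next
          case f: False
          have "sqrt T * min (v / T) 1 \<le> sqrt T * 1"
            using elim by (intro mult_left_mono) auto
          also have "\<dots> \<le> sqrt v" using f by simp
          finally show ?thesis .
        qed
        then have "\<bar>sqrt T * min (v / T) 1\<bar> * \<bar>majorant v\<bar> \<le> \<bar>sqrt v\<bar> * \<bar>majorant v\<bar>"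
          using False elim by (intro mult_right_mono) auto
        then show ?thesis by (simp add: abs_mult mult.assoc)
      qed (simp add: majorant_neg)
      then show ?case by simp
    qed
  qed simp
  then show ?thesis
    by (simp add: tail_rate_def[abs_def])
qed

end

section \<open>The bound on the deviation, uniform in \<open>u\<close>\<close>

context subcritical_kernel
begin

text \<open>Rescaling \<open>s = T x\<close> turns the deviation into the integral of
  \<open>(F x - Q x) *v m x\<close> over \<open>[0, u]\<close>. In \<open>F x - Q x\<close>, elapsed
  times up to \<open>T (u - x)\<close> contribute a difference of two resolvents with nearby
  weights, and later times a tail of \<open>Psi\<close>; these give the summands
  \<open>L / G\<close> and 1 of the constant.\<close>

lemma norm_deviation_le:
  fixes g h :: "real \<Rightarrow> real" and m :: "real \<Rightarrow> real ^ 'p"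
  assumes h: "\<And>x. 0 \<le> h x" "\<And>x. h x \<le> G" "\<And>x y. \<bar>h x - h y\<bar> \<le> L * min \<bar>x - y\<bar> 1"
    and L: "0 \<le> L" and gh: "\<And>x. x \<in> {0..1} \<Longrightarrow> g x = h x"
    and m: "continuous_on {0..1} m" and M: "\<And>x. x \<in> {0..1} \<Longrightarrow> norm (m x) \<le> M"
    and K: "0 \<le> K" "\<And>(A :: real ^ 'p ^ 'p) y. norm (A *v y) \<le> norm A * norm y * K"
    and T: "T > 0" and u: "u \<in> {0..1}"
  shows "norm (deviation g \<phi> m T u) \<le> K * M * (L / G + 1) * tail_rate T"
proof -
  have M0: "0 \<le> M"
    using M[of 0] by (auto intro: order_trans[OF norm_ge_zero])
  have hL: "\<bar>h x - h y\<bar> \<le> L * \<bar>x - y\<bar>" for x y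
    using h(3)[of x y] mult_left_mono[OF min.cobounded1 L, of "\<bar>x - y\<bar>" 1] by linarith
  have "L-lipschitz_on UNIV h"
    using hL L by (intro lipschitz_onI) (auto simp: dist_real_def)
  then have h_cont: "continuous_on UNIV h"
    by (rule lipschitz_on_continuous_on)
  \<comment> \<open>The weight seen after elapsed time \<open>v\<close> when starting at rescaled
    time \<open>x\<close>; it is compared with its initial value \<open>h x\<close>.\<close>
  define \<Gamma> where "\<Gamma> x v = h (x + v / T)" for x v
  have bw\<Gamma>: "bounded_weight G (\<Gamma> x)" for x
  proof -
    have "\<Gamma> x \<in> borel_measurable borel"
      unfolding \<Gamma>_def by (intro borel_measurable_continuous_onI continuous_on_compose2[OF h_cont] continuous_intros) (use T in auto)
    then show ?thesis
      using h by (simp add: bounded_weight_def \<Gamma>_def measurable_completion)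
  qed
  have bwh: "bounded_weight G (\<lambda>_. h x)" for x
    using h by (simp add: bounded_weight_def)
  define F where "F x = (\<integral>v. indicator {0..T * (u - x)} v *\<^sub>R Res (\<Gamma> x) v \<partial>lebesgue)" for x
  define Q where "Q x = (\<integral>v. indicator {0..} v *\<^sub>R Res (\<lambda>_. h x) v \<partial>lebesgue)" for x
  have F_int: "integrable lebesgue (\<lambda>v. indicator {0..T * (u - x)} v *\<^sub>R Res (\<Gamma> x) v)" for x
    by (intro integrable_mult_indicator integrable_Res bw\<Gamma>) simp
  have Q_int: "integrable lebesgue (\<lambda>v. indicator {0..} v *\<^sub>R Res (\<lambda>_. h x) v)" for x
    by (intro integrable_mult_indicator integrable_Res bwh) simp
  have F_cont: "continuous_on UNIV F"
    unfolding F_def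
  proof (rule continuous_integral_Res[OF bw\<Gamma>])
    show "indicator {0..T * (u - x)} \<in> borel_measurable lebesgue" for x
      by (rule borel_measurable_indicator) simp
    show "\<bar>\<Gamma> x v - \<Gamma> y v\<bar> \<le> L * \<bar>x - y\<bar>" for x y v
      using hL[of "x + v / T" "y + v / T"] by (simp add: \<Gamma>_def)
    show "AE v in lebesgue. isCont (\<lambda>x. indicator {0..T * (u - x)} v :: real) x" for x
    proof -
      \<comment> \<open>As a function of \<open>x\<close>, the indicator can jump at the given point
        only if \<open>v\<close> is the upper endpoint there, and this is a single value of
        \<open>v\<close>.\<close>
      have "AE v in lebesgue. v \<noteq> T * (u - x)"
        by (intro AE_completion AE_lborel_singleton)
      then show ?thesis
      proof eventually_elim
        case (elim v)
        have cont: "((\<lambda>y. T * (u - y)) \<longlongrightarrow> T * (u - x)) (nhds x)"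
          by (intro tendsto_intros filterlim_ident)
        show ?case
        proof (cases "v < T * (u - x)")
          case True
          then have "\<forall>\<^sub>F y in nhds x. v < T * (u - y)"
            by (rule order_tendstoD(1)[OF cont])
          then have "\<forall>\<^sub>F y in nhds x. indicator {0..T * (u - y)} v = (indicator {0..} v :: real)"
            by eventually_elim (auto simp: indicator_def)
          then show ?thesis
            by (subst isCont_cong) auto
        next
          case False
          then have "T * (u - x) < v" using elim by simp
          then have "\<forall>\<^sub>F y in nhds x. T * (u - y) < v"
            by (rule order_tendstoD(2)[OF cont])
          then have "\<forall>\<^sub>F y in nhds x. indicator {0..T * (u - y)} v = (0 :: real)"
            by eventually_elim (auto simp: indicator_def)
          then show ?thesis
            by (subst isCont_cong) auto
        qed
      qed
    qed
  qed (auto simp: indicator_def)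
  have Q_cont: "continuous_on UNIV Q"
    unfolding Q_def
  proof (rule continuous_integral_Res[OF bwh hL])
    show "(indicator {0..} :: real \<Rightarrow> real) \<in> borel_measurable lebesgue"
      by (rule borel_measurable_indicator) simp
  qed (auto simp: indicator_def)
  have inner: "(\<integral>t\<in>{s..T * u}. resolvent g \<phi> T t s *v m (s / T) \<partial>lebesgue) = F (s / T) *v m (s / T)"
    if s: "s \<in> {0..T * u}" for s
  proof -
    let ?y = "m (s / T)"
    \<comment> \<open>Up to time \<open>t \<le> T u \<le> T\<close> the weight is evaluated in
      \<open>[0,1]\<close> only, where \<open>g\<close> and \<open>h\<close> agree, so causality
      applies.\<close>
    have res: "resolvent g \<phi> T t s = Res (\<Gamma> (s / T)) (t - s)" if t: "t \<in> {s..T * u}" for t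
    proof -
      have "weighted_iterate (\<lambda>v. g ((s + v) / T)) \<phi> i (t - s) = weighted_iterate (\<Gamma> (s / T)) \<phi> i (t - s)" for i
      proof (rule weighted_iterate_cong[where V = "t - s"])
        fix v assume v: "0 \<le> v" "v \<le> t - s"
        have "t \<le> T * u" using t by simp
        also have "\<dots> \<le> T * 1" using u T by (intro mult_left_mono) auto
        finally have "(s + v) / T \<in> {0..1}"
          using v s T by (auto simp: field_simps)
        then show "g ((s + v) / T) = \<Gamma> (s / T) v"
          using gh by (simp add: \<Gamma>_def add_divide_distrib)
      qed (use nonneg_kernel_entry(3)[OF \<phi>] in auto)
      then show ?thesis
        unfolding resolvent_def Res_def volterra_power_kernel by simp
    qed
    have "(\<integral>t\<in>{s..T * u}. resolvent g \<phi> T t s *v ?y \<partial>lebesgue) =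
        (\<integral>t. (indicator {s..T * u} t *\<^sub>R Res (\<Gamma> (s / T)) (t - s)) *v ?y \<partial>lebesgue)"
      unfolding set_lebesgue_integral_def
      by (intro Bochner_Integration.integral_cong) (auto simp: indicator_def res)
    also have "\<dots> = (\<integral>v. (indicator {s..T * u} (s + 1 * v) *\<^sub>R Res (\<Gamma> (s / T)) (s + 1 * v - s)) *v ?y \<partial>lebesgue)"
      by (subst lebesgue_integral_real_affine[of 1 _ s]) simp_all
    also have "\<dots> = (\<integral>v. (indicator {0..T * (u - s / T)} v *\<^sub>R Res (\<Gamma> (s / T)) v) *v ?y \<partial>lebesgue)"
      using T by (intro Bochner_Integration.integral_cong) (auto simp: indicator_def algebra_simps)
    also have "\<dots> = F (s / T) *v ?y"
      unfolding F_def
      by (rule integral_bounded_linear[OF bounded_bilinear.bounded_linear_left[OF bounded_bilinear_matrix_vector_mult] F_int])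
    finally show ?thesis .
  qed
  have Psi_eq: "(\<integral>s\<in>{0..}. Psi g \<phi> x s \<partial>lebesgue) = Q x" if "x \<in> {0..u}" for x
  proof -
    have "g x = h x" using that u gh by auto
    then show ?thesis
      unfolding Q_def set_lebesgue_integral_def Psi_def Res_def weighted_iterate_const by simp
  qed
  have cont_u: "continuous_on {0..u} m"
    using continuous_on_subset[OF m] u by auto
  have int: "set_integrable lebesgue {0..u} (\<lambda>x. R x *v m x)" if "continuous_on UNIV R" for R :: "real \<Rightarrow> real ^ 'p ^ 'p"
    by (intro absolutely_integrable_continuous_real
        bounded_bilinear.continuous_on[OF bounded_bilinear_matrix_vector_mult] cont_u
        continuous_on_subset[OF that]) simp
  have "(1 / T) *\<^sub>R (\<integral>s\<in>{0..T * u}. (\<integral>t\<in>{s..T * u}. resolvent g \<phi> T t s *v m (s / T) \<partial>lebesgue) \<partial>lebesgue) =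
      (1 / T) *\<^sub>R (\<integral>s. indicator {0..T * u} s *\<^sub>R (F (s / T) *v m (s / T)) \<partial>lebesgue)"
    unfolding set_lebesgue_integral_def[of lebesgue "{0..T * u}"]
    by (intro arg_cong[where f = "\<lambda>x. (1 / T) *\<^sub>R x"] Bochner_Integration.integral_cong)
      (auto simp: indicator_def inner)
  \<comment> \<open>The Jacobian of \<open>s = T x\<close> cancels the prefactor
    \<open>1 / T\<close>.\<close>
  also have "\<dots> = (\<integral>x. indicator {0..T * u} (0 + T * x) *\<^sub>R (F ((0 + T * x) / T) *v m ((0 + T * x) / T)) \<partial>lebesgue)"
    using T by (subst lebesgue_integral_real_affine[of T _ 0]) simp_all
  also have "\<dots> = (\<integral>x\<in>{0..u}. F x *v m x \<partial>lebesgue)"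
    unfolding set_lebesgue_integral_def using T
    by (intro Bochner_Integration.integral_cong) (auto simp: indicator_def zero_le_mult_iff)
  finally have first: "(1 / T) *\<^sub>R (\<integral>s\<in>{0..T * u}. (\<integral>t\<in>{s..T * u}. resolvent g \<phi> T t s *v m (s / T) \<partial>lebesgue) \<partial>lebesgue) =
      (\<integral>x\<in>{0..u}. F x *v m x \<partial>lebesgue)" .
  have second: "(\<integral>x\<in>{0..u}. (\<integral>s\<in>{0..}. Psi g \<phi> x s \<partial>lebesgue) *v m x \<partial>lebesgue) = (\<integral>x\<in>{0..u}. Q x *v m x \<partial>lebesgue)"
    unfolding set_lebesgue_integral_def[of lebesgue "{0..u}"]
    by (intro Bochner_Integration.integral_cong) (auto simp: indicator_def Psi_eq)
  have dev: "deviation g \<phi> m T u = (\<integral>x\<in>{0..u}. (F x - Q x) *v m x \<partial>lebesgue)"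
    unfolding deviation_def first second
    by (simp add: set_integral_diff(2)[OF int[OF F_cont] int[OF Q_cont], symmetric] matrix_vector_mult_diff_rdistrib)
  have FQ_cont: "continuous_on UNIV (\<lambda>x. F x - Q x)"
    by (intro continuous_intros F_cont Q_cont)
  let ?tail = "\<lambda>x. \<integral>\<^sup>+v. (if T * (u - x) < v then ennreal (majorant v) else 0) \<partial>lebesgue"
  have maj_meas: "(\<lambda>v. ennreal (majorant v)) \<in> borel_measurable lebesgue"
    using integrable_majorant by auto
  have FQ: "ennreal (norm (F x - Q x)) \<le> ennreal (L / G * tail_rate T) + ?tail x" if x: "x \<in> {0..u}" for x
  proof -
    have "ennreal (norm (F x - Q x)) \<le>
        (\<integral>\<^sup>+v. ennreal (norm (indicator {0..T * (u - x)} v *\<^sub>R Res (\<Gamma> x) v - indicator {0..} v *\<^sub>R Res (\<lambda>_. h x) v)) \<partial>lebesgue)"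
      unfolding F_def Q_def Bochner_Integration.integral_diff[OF F_int Q_int, symmetric]
      by (intro integral_norm_bound_ennreal Bochner_Integration.integrable_diff F_int Q_int)
    also have "\<dots> \<le> (\<integral>\<^sup>+v. ennreal (L / G) * ennreal (min (v / T) 1 * majorant v) +
        (if T * (u - x) < v then ennreal (majorant v) else 0) \<partial>lebesgue)"
    proof (rule nn_integral_mono_AE)
      have "AE v in lebesgue. norm (Res (\<Gamma> x) v - Res (\<lambda>_. h x) v) \<le> L * min (v / T) 1 / G * majorant v"
      proof (rule norm_Res_diff_le[where \<delta> = "\<lambda>v. L * min (v / T) 1", OF bw\<Gamma> bwh])
        show "\<bar>\<Gamma> x v - h x\<bar> \<le> L * min (v / T) 1" if "0 \<le> v" for v
          using h(3)[of "x + v / T" x] that T by (simp add: \<Gamma>_def)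
        show "L * min (v / T) 1 \<le> L * min (v' / T) 1" if "0 \<le> v" "v \<le> v'" for v v'
          using that T L by (intro mult_left_mono min.mono divide_right_mono) auto
      qed
      then show "AE v in lebesgue. ennreal (norm (indicator {0..T * (u - x)} v *\<^sub>R Res (\<Gamma> x) v - indicator {0..} v *\<^sub>R Res (\<lambda>_. h x) v))
          \<le> ennreal (L / G) * ennreal (min (v / T) 1 * majorant v) + (if T * (u - x) < v then ennreal (majorant v) else 0)"
        using norm_Res_le[OF bwh[of x]] AE_majorant_nonneg
      proof eventually_elim
        case (elim v)
        have eq: "ennreal (L / G) * ennreal (min (v / T) 1 * majorant v) = ennreal (L * min (v / T) 1 / G * majorant v)"
          using L G min_majorant_nonneg[OF T elim(3)]
          by (simp add: mult.assoc flip: ennreal_mult)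
        \<comment> \<open>Both integrands vanish for negative \<open>v\<close>; before the cutoff
          the comparison of weights applies, and beyond it only the resolvent of the constant weight
          survives.\<close>
        consider "v < 0" | "0 \<le> v" "v \<le> T * (u - x)" | "0 \<le> v" "T * (u - x) < v" by linarith
        then show ?case
        proof cases
          case 1
          then show ?thesis by (simp add: indicator_def)
        next
          case 2
          then show ?thesis
            unfolding eq using elim(1) by (auto simp: indicator_def intro!: ennreal_leI)
        next
          case 3
          then show ?thesis
            using elim(2) by (auto simp: indicator_def intro!: add_increasing ennreal_leI)
        qed
      qed
    qed
    also have "\<dots> = (\<integral>\<^sup>+v. ennreal (L / G) * ennreal (min (v / T) 1 * majorant v) \<partial>lebesgue) + ?tail x"
    proof (rule nn_integral_add)
      show "(\<lambda>v. ennreal (L / G) * ennreal (min (v / T) 1 * majorant v)) \<in> borel_measurable lebesgue"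
        by (intro borel_measurable_times_ennreal borel_measurable_const
            measurable_compose[OF borel_measurable_min_majorant measurable_ennreal])
      have "(\<lambda>v. indicator {T * (u - x)<..} v * ennreal (majorant v)) \<in> borel_measurable lebesgue"
        by (intro borel_measurable_times_ennreal maj_meas borel_measurable_indicator) simp
      moreover have "(\<lambda>v. indicator {T * (u - x)<..} v * ennreal (majorant v)) =
          (\<lambda>v. if T * (u - x) < v then ennreal (majorant v) else 0)"
        by (auto simp: indicator_def)
      ultimately show "(\<lambda>v. if T * (u - x) < v then ennreal (majorant v) else 0) \<in> borel_measurable lebesgue"
        by simp
    qed
    also have "(\<integral>\<^sup>+v. ennreal (L / G) * ennreal (min (v / T) 1 * majorant v) \<partial>lebesgue) = ennreal (L / G * tail_rate T)"
    proof -
      have "(\<lambda>v. ennreal (min (v / T) 1 * majorant v)) \<in> borel_measurable lebesgue"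
        by (intro measurable_compose[OF borel_measurable_min_majorant measurable_ennreal])
      then show ?thesis
        using L G tail_rate_nonneg[OF T] by (simp add: nn_integral_cmult nn_integral_min_majorant[OF T] ennreal_mult[symmetric])
    qed
    finally show ?thesis .
  qed
  have "ennreal (norm (deviation g \<phi> m T u)) \<le>
      (\<integral>\<^sup>+x. ennreal (norm (indicator {0..u} x *\<^sub>R ((F x - Q x) *v m x))) \<partial>lebesgue)"
    unfolding dev set_lebesgue_integral_def
    by (rule integral_norm_bound_ennreal) (use int[OF FQ_cont] in \<open>simp add: set_integrable_def\<close>)
  also have "\<dots> \<le> (\<integral>\<^sup>+x. ennreal (K * M) * (ennreal (L / G * tail_rate T) * indicator {0..u} x + indicator {0..u} x * ?tail x) \<partial>lebesgue)"
  proof (rule nn_integral_mono)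
    fix x
    show "ennreal (norm (indicator {0..u} x *\<^sub>R ((F x - Q x) *v m x))) \<le>
        ennreal (K * M) * (ennreal (L / G * tail_rate T) * indicator {0..u} x + indicator {0..u} x * ?tail x)"
    proof (cases "x \<in> {0..u}")
      case True
      have "norm ((F x - Q x) *v m x) \<le> norm (F x - Q x) * norm (m x) * K"
        by (rule K(2))
      also have "\<dots> \<le> norm (F x - Q x) * M * K"
        using M[of x] True u K(1) by (intro mult_right_mono mult_left_mono) auto
      finally have "ennreal (norm ((F x - Q x) *v m x)) \<le> ennreal (K * M * norm (F x - Q x))"
        by (intro ennreal_leI) (simp add: mult_ac)
      also have "\<dots> = ennreal (K * M) * ennreal (norm (F x - Q x))"
        using K(1) M0 by (simp add: ennreal_mult)
      also have "\<dots> \<le> ennreal (K * M) * (ennreal (L / G * tail_rate T) + ?tail x)"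
        by (intro mult_left_mono FQ True) simp
      finally show ?thesis
        using True by simp
    qed simp
  qed
  also have "\<dots> = ennreal (K * M) * (ennreal (L / G * tail_rate T) * emeasure lebesgue {0..u} +
      (\<integral>\<^sup>+x. indicator {0..u} x * ?tail x \<partial>lebesgue))"
  proof -
    have "?tail \<in> borel_measurable lebesgue"
      using u by (intro measurable_completion) (simp add: borel_measurable_nn_tail[OF maj_meas T])
    then have tail: "(\<lambda>x. indicator {0..u} x * ?tail x) \<in> borel_measurable lebesgue"
      by (intro borel_measurable_times_ennreal borel_measurable_indicator) simp_all
    have const: "(\<lambda>x. ennreal (L / G * tail_rate T) * indicator {0..u} x) \<in> borel_measurable lebesgue"
      by (intro borel_measurable_times_ennreal borel_measurable_const borel_measurable_indicator) simp
    have "{0..u} \<in> sets lebesgue" by simp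
    then show ?thesis
      by (simp only: nn_integral_cmult[OF borel_measurable_add[OF const tail]]
          nn_integral_add[OF const tail] nn_integral_cmult_indicator)
  qed
  \<comment> \<open>For \<open>x\<close> near \<open>u\<close> the tail need not be small; its
    integral over \<open>x\<close> is, being at most \<open>tail_rate T\<close>. The other summand
    is constant on a set of measure \<open>u \<le> 1\<close>.\<close>
  also have "\<dots> \<le> ennreal (K * M) * (ennreal (L / G * tail_rate T) * 1 + ennreal (tail_rate T))"
    using u nn_integral_tail_le[OF maj_meas T, of u, unfolded nn_integral_min_mult_majorant[OF T]]
    by (intro mult_left_mono add_mono) auto
  also have "\<dots> = ennreal (K * M * (L / G + 1) * tail_rate T)"
    using K(1) M0 L G tail_rate_nonneg[OF T]
    by (simp add: ennreal_mult[symmetric] ennreal_plus[symmetric] algebra_simps del: ennreal_plus)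
  finally show ?thesis
    using K(1) M0 L G tail_rate_nonneg[OF T] by (subst (asm) ennreal_le_iff) auto
qed

end

section \<open>Extension of \<open>g\<close>, arbitrary norms and choice of constants\<close>

text \<open>The derivative is bounded on the compact interval, so \<open>g\<close> is Lipschitz
  there; clamping is a contraction onto an interval of length 1, which accounts for the
  minimum.\<close>

lemma clamp_lipschitz:
  fixes g :: "real \<Rightarrow> real"
  assumes "\<exists>g'. (\<forall>x\<in>{0..1}. (g has_real_derivative g' x) (at x within {0..1})) \<and> continuous_on {0..1} g'"
  obtains L where "L \<ge> 0"
    "\<And>x y. \<bar>g (max 0 (min 1 x)) - g (max 0 (min 1 y))\<bar> \<le> L * min \<bar>x - y\<bar> 1"
proof -
  obtain g' where g': "\<And>x. x \<in> {0..1} \<Longrightarrow> (g has_real_derivative g' x) (at x within {0..1})"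
      "continuous_on {0..1} g'"
    using assms by blast
  have "compact (g' ` {0..1})"
    by (intro compact_continuous_image g') simp
  then obtain L where L: "\<And>x. x \<in> {0..1} \<Longrightarrow> norm (g' x) \<le> L"
    by (meson compact_imp_bounded bounded_iff imageI)
  have "0 \<le> L"
    using L[of 0] by (auto intro: order_trans[OF norm_ge_zero])
  moreover have "\<bar>g (max 0 (min 1 x)) - g (max 0 (min 1 y))\<bar> \<le> L * min \<bar>x - y\<bar> 1" for x y
  proof -
    have "norm (g (max 0 (min 1 x)) - g (max 0 (min 1 y))) \<le> L * norm (max 0 (min 1 x) - max 0 (min 1 y))"
      by (rule field_differentiable_bound[where S = "{0..1}", OF _ g'(1) L]) auto
    also have "\<dots> \<le> L * min \<bar>x - y\<bar> 1"
      using \<open>0 \<le> L\<close> by (intro mult_left_mono) auto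
    finally show ?thesis by simp
  qed
  ultimately show thesis using that by blast
qed

text \<open>The triangle inequality for \<open>x\<close> and \<open>- x\<close> gives
  \<open>0 = N 0 \<le> 2 N x\<close>.\<close>

lemma is_norm_nonneg:
  assumes "is_norm N"
  shows "0 \<le> N x"
proof -
  note N = assms[unfolded is_norm_def]
  have "N (x + (-1) *\<^sub>R x) \<le> N x + N ((-1) *\<^sub>R x)"
    by (rule N[THEN conjunct2, THEN conjunct1, rule_format])
  moreover have "N ((-1) *\<^sub>R x) = \<bar>-1\<bar> * N x"
    by (rule N[THEN conjunct2, THEN conjunct2, rule_format])
  moreover have "N 0 = 0"
    using N by simp
  ultimately show ?thesis by simp
qed

lemma is_norm_sum_le:
  assumes "is_norm N" "finite A"
  shows "N (\<Sum>i\<in>A. f i) \<le> (\<Sum>i\<in>A. N (f i))"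
  using assms(2)
proof induction
  case empty
  have "N 0 = 0" using assms(1) by (simp add: is_norm_def)
  then show ?case by simp
next
  case (insert i A)
  have "N (f i + (\<Sum>i\<in>A. f i)) \<le> N (f i) + N (\<Sum>i\<in>A. f i)"
    using assms(1) by (simp add: is_norm_def)
  with insert show ?case by simp
qed

text \<open>Expand in the standard basis. This half of the equivalence of norms transfers the
  Euclidean bound on the deviation to \<open>N\<close>.\<close>

lemma is_norm_le_norm:
  fixes N :: "real ^ 'n \<Rightarrow> real"
  assumes N: "is_norm N"
  obtains C where "C > 0" "\<And>x. N x \<le> C * norm x"
proof -
  define C where "C = 1 + (\<Sum>i\<in>UNIV. N (axis i 1))"
  have "N x \<le> C * norm x" for x
  proof -
    have "x = (\<Sum>i\<in>UNIV. x $ i *\<^sub>R axis i 1)"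
      using basis_expansion[of x] by (simp add: scalar_mult_eq_scaleR)
    then have "N x \<le> (\<Sum>i\<in>UNIV. N (x $ i *\<^sub>R axis i 1))"
      using is_norm_sum_le[OF N, of UNIV "\<lambda>i. x $ i *\<^sub>R axis i 1"] by simp
    also have "\<dots> = (\<Sum>i\<in>UNIV. \<bar>x $ i\<bar> * N (axis i 1))"
      using N by (simp add: is_norm_def)
    also have "\<dots> \<le> (\<Sum>i\<in>UNIV. norm x * N (axis i 1))"
      using is_norm_nonneg[OF N] by (intro sum_mono mult_right_mono component_le_norm_cart)
    also have "\<dots> \<le> C * norm x"
      by (simp add: C_def sum_distrib_left algebra_simps flip: sum_distrib_left sum_distrib_right)
    finally show ?thesis .
  qed
  moreover have "C > 0"
    unfolding C_def using is_norm_nonneg[OF N] by (simp add: add_pos_nonneg sum_nonneg)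
  ultimately show thesis using that by blast
qed


lemma nonneg_kernelI:
  assumes "\<forall>t<0. \<phi> t = 0" "\<forall>t\<ge>0. \<forall>k l. \<phi> t $ k $ l \<ge> 0"
    and "\<forall>k l. set_integrable lebesgue {0..} (\<lambda>t. \<phi> t $ k $ l)"
  shows "nonneg_kernel \<phi>"
proof -
  have "integrable lebesgue (\<lambda>t. \<phi> t $ k $ l)" for k l
  proof -
    have "\<phi> t $ k $ l = indicator {0..} t *\<^sub>R \<phi> t $ k $ l" for t
      using assms(1) by (cases "t < 0") auto
    then have "(\<lambda>t. \<phi> t $ k $ l) = (\<lambda>t. indicator {0..} t *\<^sub>R \<phi> t $ k $ l)"
      by (rule ext)
    then show ?thesis
      using assms(3) by (simp add: set_integrable_def)
  qed
  then show ?thesis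
    unfolding nonneg_kernel_def integrable_vec_iff using assms(1,2) by (metis not_le order_refl zero_index)
qed

text \<open>The comparison of weights divides by \<open>G\<close>, while the supremum
  \<open>c\<close> of \<open>g\<close> may be 0. Hence \<open>c\<close> is enlarged by a small
  \<open>\<epsilon>\<close>, paid for with half of the gap \<open>1 - \<rho>\<close>.\<close>

lemma subcritical_kernel_exists:
  fixes \<phi> :: "real \<Rightarrow> real ^ 'p ^ 'p"
  assumes \<phi>: "nonneg_kernel \<phi>" and c: "0 \<le> c"
    and sr: "spectral_radius (cmat_of (\<chi> k l. c * (\<integral>t. \<phi> t $ k $ l \<partial>lebesgue))) < 1"
  obtains G \<rho> w where "c \<le> G" "subcritical_kernel \<phi> G \<rho> w"
proof -
  define A where "A k l = (\<integral>t. \<phi> t $ k $ l \<partial>lebesgue)" for k l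
  have A: "0 \<le> A k l" for k l
    unfolding A_def using nonneg_kernel_entry(2)[OF \<phi>] by simp
  define A' :: "real ^ 'p ^ 'p" where "A' = (\<chi> k l. c * A k l)"
  have sr': "spectral_radius (cmat_of A') < 1"
    using sr by (simp only: A'_def A_def)
  have A': "0 \<le> A' $ k $ l" for k l
    using A c by (simp add: A'_def)
  obtain w \<rho> where \<rho>: "0 < \<rho>" "\<rho> < 1" and w: "\<And>k. w k \<ge> (1::real)"
    and "\<And>k. (\<Sum>l\<in>UNIV. A' $ k $ l * w l) \<le> \<rho> * w k"
    by (rule spectral_radius_less_1_strict_supersolution[OF A' sr'], rule that)
  then have sup: "\<And>k. (\<Sum>l\<in>UNIV. c * A k l * w l) \<le> \<rho> * w k"
    by (simp add: A'_def)
  have w0: "0 \<le> w k" for k using w[of k] by linarith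
  define C where "C = (\<Sum>k\<in>UNIV. \<Sum>l\<in>UNIV. A k l * w l)"
  have row: "(\<Sum>l\<in>UNIV. A k l * w l) \<le> C" and C: "0 \<le> C" for k
    unfolding C_def using A w0
    by (auto intro!: member_le_sum[where f = "\<lambda>k. \<Sum>l\<in>UNIV. A k l * w l"] sum_nonneg)
  \<comment> \<open>Chosen so that \<open>\<epsilon> C \<le> (1 - \<rho>) / 2\<close>;
    \<open>C + 1\<close> avoids a zero denominator, and \<open>w k \<ge> 1\<close> later absorbs
    this constant into a multiple of \<open>w k\<close>.\<close>
  define \<epsilon> where "\<epsilon> = (1 - \<rho>) / (2 * (C + 1))"
  have \<epsilon>: "0 < \<epsilon>" "\<epsilon> * C \<le> (1 - \<rho>) / 2"
    using \<rho> C by (auto simp: \<epsilon>_def field_simps)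
  have "subcritical_kernel \<phi> (c + \<epsilon>) ((1 + \<rho>) / 2) w"
  proof
    fix k
    have "(\<Sum>l\<in>UNIV. (c + \<epsilon>) * A k l * w l) = (\<Sum>l\<in>UNIV. c * A k l * w l) + \<epsilon> * (\<Sum>l\<in>UNIV. A k l * w l)"
      by (simp add: distrib_right sum.distrib sum_distrib_left mult.assoc)
    also have "\<dots> \<le> \<rho> * w k + \<epsilon> * C"
      using \<epsilon> by (intro add_mono sup mult_left_mono row) simp
    also have "\<dots> \<le> \<rho> * w k + (1 - \<rho>) / 2 * w k"
    proof (intro add_left_mono order_trans[OF \<epsilon>(2)])
      have "(1 - \<rho>) / 2 * 1 \<le> (1 - \<rho>) / 2 * w k"
        using \<rho> w by (intro mult_left_mono) auto
      then show "(1 - \<rho>) / 2 \<le> (1 - \<rho>) / 2 * w k" by simp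
    qed
    finally show "(\<Sum>l\<in>UNIV. (c + \<epsilon>) * (\<integral>t. \<phi> t $ k $ l \<partial>lebesgue) * w l) \<le> (1 + \<rho>) / 2 * w k"
      by (simp add: A_def field_simps)
  qed (use \<phi> c \<epsilon> \<rho> w in auto)
  then show thesis using that[of "c + \<epsilon>"] \<epsilon> by simp
qed

section \<open>Both convergence statements from the uniform bound\<close>

theorem proposition3:
  fixes g :: "real \<Rightarrow> real"
    and \<phi> :: "real \<Rightarrow> real ^ 'p ^ 'p"
    and m :: "real \<Rightarrow> real ^ 'p"
    and N :: "real ^ 'p \<Rightarrow> real"
  assumes "is_norm N"
    and "\<forall>x\<in>{0..1}. g x \<ge> 0"
    and "\<exists>g'. (\<forall>x\<in>{0..1}. (g has_real_derivative g' x) (at x within {0..1})) \<and>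
              continuous_on {0..1} g'"
    and "\<phi> \<in> borel_measurable lebesgue"
    and "\<forall>t<0. \<phi> t = 0"
    and "\<forall>t\<ge>0. \<forall>k l. \<phi> t $ k $ l \<ge> 0"
    and "\<forall>k l. set_integrable lebesgue {0..} (\<lambda>t. \<phi> t $ k $ l)"
    and "spectral_radius (cmat_of
           (\<chi> k l. (SUP x\<in>{0..1}. g x) * (LINT t:{0..}|lebesgue. \<phi> t $ k $ l))) < 1"
    and "continuous_on {0..1} m"
  shows "((\<lambda>T. SUP u\<in>{0..1}. N (deviation g \<phi> m T u)) \<longlongrightarrow> 0) at_top \<and>
    ((\<exists>L. L-lipschitz_on {0..1} m) \<and>
     (\<forall>k l. set_integrable lebesgue {0..} (\<lambda>s. \<phi> s $ k $ l * sqrt s)) \<longrightarrow>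
     (\<lambda>T. SUP u\<in>{0..1}. N (deviation g \<phi> m T u)) \<in> o[at_top](\<lambda>T. 1 / sqrt T))"
proof -
  have \<phi>: "nonneg_kernel \<phi>"
    by (rule nonneg_kernelI[OF assms(5-7)])
  have "continuous_on {0..1} g"
    using assms(3) by (auto intro: DERIV_continuous_on)
  then have "bdd_above (g ` {0..1})"
    by (intro bounded_imp_bdd_above compact_imp_bounded compact_continuous_image) auto
  then have g_le: "g x \<le> (SUP x\<in>{0..1}. g x)" if "x \<in> {0..1}" for x
    by (rule cSUP_upper[OF that])
  have c0: "0 \<le> (SUP x\<in>{0..1}. g x)"
    using g_le[of 0] assms(2)[rule_format, of 0] by simp
  have "indicator {0..} t *\<^sub>R \<phi> t $ k $ l = \<phi> t $ k $ l" for t k l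
    using assms(5) by (cases "t < 0") auto
  then have "(LINT t:{0..}|lebesgue. \<phi> t $ k $ l) = (\<integral>t. \<phi> t $ k $ l \<partial>lebesgue)" for k l
    by (simp only: set_lebesgue_integral_def)
  then have sr: "spectral_radius (cmat_of
      (\<chi> k l. (SUP x\<in>{0..1}. g x) * (\<integral>t. \<phi> t $ k $ l \<partial>lebesgue))) < 1"
    using assms(8) by (simp only:)
  obtain G \<rho> w where g_G: "(SUP x\<in>{0..1}. g x) \<le> G" and "subcritical_kernel \<phi> G \<rho> w"
    by (rule subcritical_kernel_exists[OF \<phi> c0 sr])
  then interpret subcritical_kernel \<phi> G \<rho> w by simp
  \<comment> \<open>Clamping the argument extends \<open>g\<close> to the real line and keeps the
    bounds 0 and \<open>G\<close>, as the weights must be defined at all elapsed times.\<close>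
  define h where "h x = g (max 0 (min 1 x))" for x
  obtain L where L: "L \<ge> 0" and h_lip: "\<And>x y. \<bar>h x - h y\<bar> \<le> L * min \<bar>x - y\<bar> 1"
    using clamp_lipschitz[OF assms(3)] unfolding h_def by blast
  have clamp: "max 0 (min 1 x) \<in> {0..1}" for x :: real
    by auto
  have h: "0 \<le> h x" "h x \<le> G" for x
    unfolding h_def using assms(2) clamp[of x] order_trans[OF g_le[OF clamp[of x]] g_G] by blast+
  obtain M where M: "\<And>x. x \<in> {0..1} \<Longrightarrow> norm (m x) \<le> M"
    using compact_imp_bounded[OF compact_continuous_image[OF assms(9) compact_Icc]]
    unfolding bounded_iff by blast
  obtain K where K: "0 \<le> K" "\<And>(A :: real ^ 'p ^ 'p) y. norm (A *v y) \<le> norm A * norm y * K"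
    using bounded_bilinear.nonneg_bounded[OF bounded_bilinear_matrix_vector_mult] by blast
  obtain CN where CN: "CN > 0" "\<And>x. N x \<le> CN * norm x"
    using is_norm_le_norm[OF assms(1)] by blast
  define C where "C = CN * (K * M * (L / G + 1))"
  let ?S = "\<lambda>T. SUP u\<in>{0..1}. N (deviation g \<phi> m T u)"
  have N_le: "N (deviation g \<phi> m T u) \<le> C * tail_rate T" if "T > 0" "u \<in> {0..1}" for T u
  proof -
    have "norm (deviation g \<phi> m T u) \<le> K * M * (L / G + 1) * tail_rate T"
    proof (rule norm_deviation_le[where h = h])
      show "g x = h x" if "x \<in> {0..1}" for x
        using that by (simp add: h_def)
    qed (fact h h_lip L assms(9) M K that)+
    then have "CN * norm (deviation g \<phi> m T u) \<le> CN * (K * M * (L / G + 1) * tail_rate T)"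
      using CN(1) by simp
    then show ?thesis
      using CN(2)[of "deviation g \<phi> m T u"] by (simp add: C_def mult.assoc)
  qed
  \<comment> \<open>The supremum is at most the uniform bound; it is nonnegative because it
    dominates the value at \<open>u = 0\<close>, the family being bounded above.\<close>
  have S: "norm (?S T) \<le> C * tail_rate T" if "T > 0" for T
  proof -
    have "?S T \<le> C * tail_rate T"
      using N_le[OF that] by (intro cSUP_least) auto
    moreover have "N (deviation g \<phi> m T 0) \<le> ?S T"
      using N_le[OF that] by (intro cSUP_upper bdd_aboveI2) auto
    moreover have "0 \<le> N (deviation g \<phi> m T 0)"
      by (rule is_norm_nonneg[OF assms(1)])
    ultimately show ?thesis by simp
  qed
  have ev: "\<forall>\<^sub>F T in at_top. norm (?S T) \<le> C * tail_rate T"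
    using eventually_gt_at_top[of 0] by eventually_elim (rule S)
  have "(?S \<longlongrightarrow> 0) at_top"
    by (rule Lim_null_comparison[OF ev tendsto_mult_right_zero[OF tail_rate_tendsto_0]])
  moreover have "?S \<in> o[at_top](\<lambda>T. 1 / sqrt T)"
    if "\<forall>k l. set_integrable lebesgue {0..} (\<lambda>s. \<phi> s $ k $ l * sqrt s)"
  proof -
    have "sqrt t * \<phi> t $ k $ l = indicator {0..} t *\<^sub>R (\<phi> t $ k $ l * sqrt t)" for k l t
      using assms(5) by (cases "t < 0") auto
    then have m: "has_sqrt_moments \<phi>"
      using that by (simp only: has_sqrt_moments_def set_integrable_def simp_thms)
    show ?thesis
    proof (rule smalloI_tendsto)
      have "\<forall>\<^sub>F T in at_top. norm (?S T / (1 / sqrt T)) \<le> C * (sqrt T * tail_rate T)"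
        using eventually_gt_at_top[of 0]
      proof eventually_elim
        case (elim T)
        have "norm (?S T) * sqrt T \<le> C * tail_rate T * sqrt T"
          using S[OF elim] elim by (intro mult_right_mono) auto
        then show ?case
          using elim by (simp add: abs_mult mult_ac)
      qed
      then show "((\<lambda>T. ?S T / (1 / sqrt T)) \<longlongrightarrow> 0) at_top"
        by (rule Lim_null_comparison) (rule tendsto_mult_right_zero[OF sqrt_mult_tail_rate_tendsto_0[OF m]])
      show "\<forall>\<^sub>F T in at_top. 1 / sqrt T \<noteq> 0"
        using eventually_gt_at_top[of 0] by eventually_elim simp
    qed
  qed
  ultimately show ?thesis by blast
qed

end
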